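(* Let $k\ge1$ and let $\{(G^{(m)},s_1^{(m)},\ldots,s_k^{(m)})\}_{m\in\mathbb{N}}$ be a sequence of finite $k$-marked groups. If every member of the Cayley boundary $\partial_{\mathrm{Cay}}(\{G^{(m)}\}_m)$ has Kazhdan's property (T), then the sequence of Cayley graphs $\{\mathrm{Cay}(G^{(m)},s_1^{(m)},\ldots,s_k^{(m)})\}_m$ forms an expander family.
   Context: A $k$-marked group $(G,s_1,\ldots,s_k)$ is a group $G$ with an ordered $k$-tuple of elements generating it; two are isomorphic if a group isomorphism matches the tuples. $\mathcal{G}(k)$ is the set of isomorphism classes of $k$-marked groups, with the Cayley topology, generated by the sets $\{G : w(s_1,\ldots,s_k)=1_G\}$, $w\in F_k$ (the free group of rank $k$), and their complements; it is compact and metrizable. The Cayley boundary of a sequence is $\partial_{\mathrm{Cay}}(\{G^{(m)}\}_m)=\overline{\{G^{(m)}\}_m}\setminus\{G^{(m)}\}_m$ (closure in $\mathcal{G}(k)$). $\mathrm{Cay}(G,s_1,\ldots,s_k)$ is the graph with vertex set $G$ in which $g$ and $h$ are joined when $gh^{-1}\in\{s_1^{\pm1},\ldots,s_k^{\pm1}\}$. An expander family is a family of finite connected graphs, uniformly locally finite (uniformly bounded degree), whose combinatorial (nonnormalized) Laplacians have first positive eigenvalues bounded away from zero uniformly over the family. *)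

theory Defs
  imports
    "HOL-Analysis.Analysis"
    "HOL-Algebra.Generated_Groups"
    "HOL-Algebra.Group_Action"
    "HOL-Algebra.Module"
    "Graph_Theory.Graph_Theory"
begin

section \<open>Marked groups and the Cayley topology\<close>

definition marked_group :: "nat \<Rightarrow> 'a monoid \<Rightarrow> 'a list \<Rightarrow> bool" where
  "marked_group k G s \<longleftrightarrow>
     group G \<and> length s = k \<and> set s \<subseteq> carrier G \<and> generate G (set s) = carrier G"

definition marked_iso :: "'a monoid \<Rightarrow> 'a list \<Rightarrow> 'b monoid \<Rightarrow> 'b list \<Rightarrow> bool" where
  "marked_iso G s H t \<longleftrightarrow> (\<exists>h \<in> iso G H. map h s = t)"

text \<open>A marked group is finitely generated, hence countable, hence isomorphic to one whose
  carrier is a set of natural numbers. So isomorphism classes are taken among marked groups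
  on the type \<open>nat\<close>; the representative \<open>(G, s)\<close> of a class may live on any type.\<close>

type_synonym marked_class = "(nat monoid \<times> nat list) set"

definition marked_class_of :: "nat \<Rightarrow> 'a monoid \<Rightarrow> 'a list \<Rightarrow> marked_class" where
  "marked_class_of k G s = {(H, t). marked_group k H t \<and> marked_iso G s H t}"

definition marked_groups :: "nat \<Rightarrow> marked_class set" where
  "marked_groups k = {marked_class_of k G s | (G :: nat monoid) s. marked_group k G s}"

text \<open>The free group of rank \<open>k\<close> as the set of reduced words: the letter \<open>(i, True)\<close> is the
  \<open>i\<close>-th free generator, \<open>(i, False)\<close> its inverse.\<close>

definition free_group_words :: "nat \<Rightarrow> (nat \<times> bool) list set" where
  "free_group_words k =
     {w. (\<forall>(i, e) \<in> set w. i < k) \<and> successively (\<lambda>(i, e) (j, e'). i = j \<longrightarrow> e = e') w}"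

definition word_value :: "'a monoid \<Rightarrow> 'a list \<Rightarrow> (nat \<times> bool) list \<Rightarrow> 'a" where
  "word_value G s w =
     foldr (\<lambda>(i, e) x. (if e then s ! i else inv\<^bsub>G\<^esub> (s ! i)) \<otimes>\<^bsub>G\<^esub> x) w \<one>\<^bsub>G\<^esub>"

definition relator_set :: "nat \<Rightarrow> (nat \<times> bool) list \<Rightarrow> marked_class set" where
  "relator_set k w = {c \<in> marked_groups k. \<forall>(G, s) \<in> c. word_value G s w = \<one>\<^bsub>G\<^esub>}"

definition cayley_topology :: "nat \<Rightarrow> marked_class topology" where
  "cayley_topology k = topology_generated_by
     (\<Union>w \<in> free_group_words k. {relator_set k w, marked_groups k - relator_set k w})"

definition cayley_boundary :: "nat \<Rightarrow> (nat \<Rightarrow> marked_class) \<Rightarrow> marked_class set" where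
  "cayley_boundary k c = (cayley_topology k closure_of range c) - range c"


section \<open>Unitary representations and property (T)\<close>

definition complex_ring :: "complex ring" where
  "complex_ring = \<lparr>carrier = UNIV, mult = (*), one = 1, zero = 0, add = (+)\<rparr>"

text \<open>The ring multiplication and unit that the record \<open>module\<close> also carries play no role.\<close>

record 'v inner_product_module = "(complex, 'v) module" +
  cinner :: "'v \<Rightarrow> 'v \<Rightarrow> complex"

definition hnorm :: "'v inner_product_module \<Rightarrow> 'v \<Rightarrow> real" where
  "hnorm H x = sqrt (Re (cinner H x x))"

locale complex_hilbert_space =
  Module.module complex_ring H for H :: "'v inner_product_module" (structure) +
  assumes cinner_add_left:
      "\<lbrakk>x \<in> carrier H; y \<in> carrier H; z \<in> carrier H\<rbrakk> \<Longrightarrow>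
        cinner H (x \<oplus> y) z = cinner H x z + cinner H y z"
    and cinner_smult_left:
      "\<lbrakk>x \<in> carrier H; y \<in> carrier H\<rbrakk> \<Longrightarrow> cinner H (a \<odot>\<^bsub>H\<^esub> x) y = a * cinner H x y"
    and cinner_commute:
      "\<lbrakk>x \<in> carrier H; y \<in> carrier H\<rbrakk> \<Longrightarrow> cinner H x y = cnj (cinner H y x)"
    and cinner_nonneg: "x \<in> carrier H \<Longrightarrow> 0 \<le> Re (cinner H x x)"
    and cinner_eq_zero: "\<lbrakk>x \<in> carrier H; cinner H x x = 0\<rbrakk> \<Longrightarrow> x = \<zero>"
    and complete: "Metric_space.mcomplete (carrier H) (\<lambda>x y. hnorm H (x \<ominus> y))"

text \<open>\<open>group_action\<close> says that \<open>\<pi>\<close> is a homomorphism into the bijections of the carrier.\<close>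

definition unitary_representation ::
    "'a monoid \<Rightarrow> 'v inner_product_module \<Rightarrow> ('a \<Rightarrow> 'v \<Rightarrow> 'v) \<Rightarrow> bool" where
  "unitary_representation G H \<pi> \<longleftrightarrow>
     complex_hilbert_space H \<and> group_action G (carrier H) \<pi> \<and>
     (\<forall>g \<in> carrier G. \<forall>x \<in> carrier H. \<forall>y \<in> carrier H. \<forall>a.
        \<pi> g (x \<oplus>\<^bsub>H\<^esub> y) = \<pi> g x \<oplus>\<^bsub>H\<^esub> \<pi> g y \<and>
        \<pi> g (a \<odot>\<^bsub>H\<^esub> x) = a \<odot>\<^bsub>H\<^esub> \<pi> g x \<and>
        cinner H (\<pi> g x) (\<pi> g y) = cinner H x y)"

text \<open>Kazhdan's property (T) of a discrete group: some finite \<open>Q\<close> and \<open>\<epsilon> > 0\<close> such that every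
  unitary representation with a \<open>(Q, \<epsilon>)\<close>-invariant vector has a nonzero invariant vector.
  HOL cannot quantify over types inside a formula, so the Hilbert spaces are those whose set of
  vectors is a subset of the type \<open>nat \<Rightarrow> complex\<close>, with arbitrary operations. This type has the
  cardinality of the continuum, so up to isomorphism every Hilbert space with a dense subset of
  at most that cardinality occurs, in particular every separable one. For a countable group
  nothing is lost: the closed linear span of the orbit of a \<open>(Q, \<epsilon>)\<close>-invariant vector is a
  separable subrepresentation, so a pair \<open>(Q, \<epsilon>)\<close> that works for these spaces works for all.\<close>

definition property_T :: "'a monoid \<Rightarrow> bool" where
  "property_T G \<longleftrightarrow>
     (\<exists>Q \<epsilon>. finite Q \<and> Q \<subseteq> carrier G \<and> 0 < \<epsilon> \<and>
       (\<forall>(H :: (nat \<Rightarrow> complex) inner_product_module) \<pi>.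
          unitary_representation G H \<pi> \<and>
          (\<exists>\<xi> \<in> carrier H. \<xi> \<noteq> \<zero>\<^bsub>H\<^esub> \<and> (\<forall>q \<in> Q. hnorm H (\<pi> q \<xi> \<ominus>\<^bsub>H\<^esub> \<xi>) < \<epsilon> * hnorm H \<xi>)) \<longrightarrow>
          (\<exists>\<eta> \<in> carrier H. \<eta> \<noteq> \<zero>\<^bsub>H\<^esub> \<and> (\<forall>g \<in> carrier G. \<pi> g \<eta> = \<eta>))))"

definition class_property_T :: "marked_class \<Rightarrow> bool" where
  "class_property_T c \<longleftrightarrow> (\<forall>(G, s) \<in> c. property_T G)"


section \<open>Cayley graphs and expander families\<close>

text \<open>Undirected graphs are symmetric digraphs, as in \<open>Graph_Theory\<close>. A trivial generator gives
  loops, which do not affect the Laplacian.\<close>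

definition cayley_graph :: "'a monoid \<Rightarrow> 'a list \<Rightarrow> 'a pair_pre_digraph" where
  "cayley_graph G s =
     \<lparr>pverts = carrier G,
      parcs = {(g, h). g \<in> carrier G \<and> h \<in> carrier G \<and>
                       g \<otimes>\<^bsub>G\<^esub> inv\<^bsub>G\<^esub> h \<in> set s \<union> m_inv G ` set s}\<rparr>"

definition graph_laplacian :: "'a pair_pre_digraph \<Rightarrow> ('a \<Rightarrow> real) \<Rightarrow> 'a \<Rightarrow> real" where
  "graph_laplacian \<Gamma> f x = (\<Sum>y | (x, y) \<in> parcs \<Gamma>. f x - f y)"

definition laplacian_eigenvalue :: "'a pair_pre_digraph \<Rightarrow> real \<Rightarrow> bool" where
  "laplacian_eigenvalue \<Gamma> \<mu> \<longleftrightarrow>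
     (\<exists>f. (\<exists>x \<in> pverts \<Gamma>. f x \<noteq> 0) \<and> (\<forall>x \<in> pverts \<Gamma>. graph_laplacian \<Gamma> f x = \<mu> * f x))"

text \<open>A relation, because a graph with a single vertex has no positive eigenvalue; in a family
  such graphs satisfy the spectral condition vacuously.\<close>

definition first_positive_eigenvalue :: "'a pair_pre_digraph \<Rightarrow> real \<Rightarrow> bool" where
  "first_positive_eigenvalue \<Gamma> \<mu> \<longleftrightarrow>
     0 < \<mu> \<and> laplacian_eigenvalue \<Gamma> \<mu> \<and> (\<forall>\<nu>. 0 < \<nu> \<and> laplacian_eigenvalue \<Gamma> \<nu> \<longrightarrow> \<mu> \<le> \<nu>)"

definition expander_family :: "('i \<Rightarrow> 'a pair_pre_digraph) \<Rightarrow> bool" where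
  "expander_family \<Gamma> \<longleftrightarrow>
     (\<forall>i. pair_pseudo_graph (\<Gamma> i) \<and> Digraph_Component.connected (with_proj (\<Gamma> i))) \<and>
     (\<exists>d. \<forall>i. \<forall>v \<in> pverts (\<Gamma> i). out_degree (with_proj (\<Gamma> i)) v \<le> d) \<and>
     (\<exists>\<epsilon> > 0. \<forall>i \<mu>. first_positive_eigenvalue (\<Gamma> i) \<mu> \<longrightarrow> \<epsilon> \<le> \<mu>)"

end

theory Submission
  imports Defs "HOL-Complex_Analysis.Great_Picard"
begin

text \<open>If the Laplacian eigenvalues \<open>\<mu>\<close> of the finite groups are not bounded below, pass to a
  sequence with \<open>\<mu> \<longlonglongrightarrow> 0\<close> that converges to a marked group \<open>H\<close>, and let \<open>\<phi>(w)\<close> be the matrix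
  coefficient of a normalized eigenfunction. On a fixed word, \<open>1 - \<phi>(w)\<close> is \<open>O(\<mu>)\<close>; averaging over
  words of length \<open>N\<close> gives \<open>(1 - \<mu> / d) ^ N\<close>, so some word does no better. Hence the positive
  definite functions \<open>\<phi> ^ n\<close> with \<open>n\<close> about \<open>\<tau> / \<mu>\<close> converge to one on \<open>H\<close> that is close to 1 on a given
  finite set if \<open>\<tau>\<close> is small, but takes values close to 0. Property (T) of \<open>H\<close> forbids this. If \<open>H\<close> is
  not in the boundary, it is isomorphic to a group of the sequence, hence finite, and again no such
  function exists.\<close>

section \<open>Reproducing kernel Hilbert spaces\<close>

text \<open>A single coefficient \<open>\<phi>\<close> carries no contradiction: on each fixed word
  it tends to 1, so in the limit the eigenvectors only yield an invariant vector, which (T) permits.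
  The information sits in the rescaled defect \<open>(1 - \<phi>) / \<mu>\<close>. It stays bounded
  on each fixed word, while the eigenvalue equation forces it to grow along suitable long words; (T)
  would make it bounded, as in the Delorme-Guichardet theorem. The power \<open>\<phi> ^ n\<close>
  approximates the Schoenberg exponential of minus \<tau> times this defect. Using integer powers,
  positivity needs only Schur's product argument, and all values stay in [-1, 1], so subsequences
  converge. The Hilbert space is shaped by \<open>property_T\<close>, which quantifies over spaces
  whose vectors are functions \<open>nat \<Rightarrow> complex\<close>. A reproducing kernel space
  over a group on \<open>nat\<close> consists of such functions from the start, whereas the GNS
  completion consists of classes of Cauchy sequences. For the same reason the limit group is built
  on \<open>nat\<close>.\<close>

definition pairing :: "(real \<times> 'a) list \<Rightarrow> ('a \<Rightarrow> real) \<Rightarrow> real" where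
  "pairing c f = (\<Sum>(a, x) \<leftarrow> c. a * f x)"

definition scale :: "real \<Rightarrow> (real \<times> 'a) list \<Rightarrow> (real \<times> 'a) list" where
  "scale r c = map (\<lambda>(a, x). (r * a, x)) c"

lemma pairing_Nil [simp]: "pairing [] f = 0"
  and pairing_Cons [simp]: "pairing ((a, x) # c) f = a * f x + pairing c f"
  by (simp_all add: pairing_def)

lemma pairing_append [simp]: "pairing (c @ d) f = pairing c f + pairing d f"
  by (induction c) auto

lemma pairing_scale [simp]: "pairing (scale r c) f = r * pairing c f"
  by (induction c) (auto simp: scale_def algebra_simps)

lemma pairing_add: "pairing c (\<lambda>x. f x + g x) = pairing c f + pairing c g"
  by (induction c) (auto simp: algebra_simps)

lemma pairing_diff: "pairing c (\<lambda>x. f x - g x) = pairing c f - pairing c g"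
  by (induction c) (auto simp: algebra_simps)

lemma pairing_cmult: "pairing c (\<lambda>x. r * f x) = r * pairing c f"
  by (induction c) (auto simp: algebra_simps)

lemma pairing_const: "pairing c (\<lambda>x. r) = r * pairing c (\<lambda>x. 1)"
  by (induction c) (auto simp: algebra_simps)

lemma pairing_zero [simp]: "pairing c (\<lambda>x. 0) = 0"
  by (induction c) auto

lemma pairing_sum: "pairing c (\<lambda>x. \<Sum>z\<in>Z. f z x) = (\<Sum>z\<in>Z. pairing c (f z))"
  by (induction Z rule: infinite_finite_induct) (auto simp: pairing_add)

lemma pairing_cong: "(\<And>x. x \<in> snd ` set c \<Longrightarrow> f x = g x) \<Longrightarrow> pairing c f = pairing c g"
  by (induction c) auto

lemma pairing_swap:
  "pairing c (\<lambda>x. pairing d (\<lambda>y. F x y)) = pairing d (\<lambda>y. pairing c (\<lambda>x. F x y))"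
  by (induction c) (auto simp: pairing_add pairing_cmult)

lemma pairing_map: "pairing (map (\<lambda>(a, x). (a, h x)) c) f = pairing c (\<lambda>x. f (h x))"
  by (induction c) auto

lemma pairing_map_weight: "pairing (map (\<lambda>(a, x). (a * u x, x)) c) f = pairing c (\<lambda>x. u x * f x)"
  by (induction c) auto

lemma tendsto_pairing:
  "(\<And>x. x \<in> snd ` set c \<Longrightarrow> ((\<lambda>n. F n x) \<longlongrightarrow> f x) \<F>) \<Longrightarrow>
    ((\<lambda>n. pairing c (F n)) \<longlongrightarrow> pairing c f) \<F>"
  by (induction c) (auto intro!: tendsto_intros)

definition kform :: "('a \<Rightarrow> 'a \<Rightarrow> real) \<Rightarrow> (real \<times> 'a) list \<Rightarrow> (real \<times> 'a) list \<Rightarrow> real" where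
  "kform K c d = pairing c (\<lambda>x. pairing d (K x))"

lemma kform_append_left [simp]: "kform K (c @ c') d = kform K c d + kform K c' d"
  by (simp add: kform_def)

lemma kform_append_right [simp]: "kform K c (d @ d') = kform K c d + kform K c d'"
  by (simp add: kform_def pairing_add)

lemma kform_scale_left [simp]: "kform K (scale r c) d = r * kform K c d"
  by (simp add: kform_def)

lemma kform_scale_right [simp]: "kform K c (scale r d) = r * kform K c d"
  by (simp add: kform_def pairing_cmult)

lemma kform_Nil [simp]: "kform K [] d = 0" "kform K c [] = 0"
  by (simp_all add: kform_def)

lemma kform_map:
  "kform K (map (\<lambda>(a, x). (a, h x)) c) (map (\<lambda>(a, x). (a, h x)) d) = kform (\<lambda>x y. K (h x) (h y)) c d"
  by (simp add: kform_def pairing_map)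

lemma kform_cong:
  assumes "\<And>x y. x \<in> snd ` set c \<Longrightarrow> y \<in> snd ` set d \<Longrightarrow> K x y = K' x y"
  shows "kform K c d = kform K' c d"
  unfolding kform_def using assms by (intro pairing_cong) auto

text \<open>A list stands for the formal vector that is the sum of its weighted point masses, and
  \<open>kform\<close> is its Gram form. Points may repeat, so mapping or reweighting a combination
  never requires collecting terms.\<close>

definition combos :: "'a set \<Rightarrow> (real \<times> 'a) list set" where
  "combos A = {c. snd ` set c \<subseteq> A}"

lemma combos_append [simp]: "c @ d \<in> combos A \<longleftrightarrow> c \<in> combos A \<and> d \<in> combos A"
  by (auto simp: combos_def)

lemma combos_Nil [simp]: "[] \<in> combos A"
  and combos_Cons [simp]: "(a, x) # c \<in> combos A \<longleftrightarrow> x \<in> A \<and> c \<in> combos A"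
  by (auto simp: combos_def)

lemma combos_scale [simp]: "c \<in> combos A \<Longrightarrow> scale r c \<in> combos A"
  by (auto simp: combos_def scale_def)

text \<open>Symmetry is a separate assumption because real coefficients do not see the antisymmetric
  part of a kernel. Real kernels suffice, since Laplace eigenfunctions are taken real; the complex
  scalars are adjoined afterwards.\<close>

locale psd_kernel =
  fixes A :: "'a set" and K :: "'a \<Rightarrow> 'a \<Rightarrow> real"
  assumes sym: "\<lbrakk>x \<in> A; y \<in> A\<rbrakk> \<Longrightarrow> K x y = K y x"
    and psd: "c \<in> combos A \<Longrightarrow> 0 \<le> kform K c c"
begin

lemma kform_sym:
  assumes "c \<in> combos A" "d \<in> combos A"
  shows "kform K c d = kform K d c"
proof -
  have "kform K c d = pairing d (\<lambda>y. pairing c (\<lambda>x. K x y))"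
    unfolding kform_def by (rule pairing_swap)
  also have "\<dots> = kform K d c"
    unfolding kform_def using assms by (intro pairing_cong) (auto simp: combos_def intro: sym)
  finally show ?thesis .
qed

text \<open>In the Hilbert space with kernel vectors \<open>k_x\<close>, and \<open>k_c\<close>
  their combination, this is \<open>|f|^2 - |f - k_c|^2\<close>. Its supremum over \<open>c\<close>
  is therefore \<open>|f|^2\<close>, because the vectors \<open>k_c\<close> are dense.\<close>

definition penalty :: "('a \<Rightarrow> real) \<Rightarrow> (real \<times> 'a) list \<Rightarrow> real" where
  "penalty f c = 2 * pairing c f - kform K c c"

text \<open>Functions vanish off \<open>A\<close> so that a function of norm zero is the zero
  function and not merely zero on \<open>A\<close>.\<close>

definition rk_space :: "('a \<Rightarrow> real) set" where
  "rk_space = {f. (\<forall>x. x \<notin> A \<longrightarrow> f x = 0) \<and> bdd_above (penalty f ` combos A)}"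

text \<open>The squared norm of the reproducing kernel Hilbert space, written as the Legendre
  transform of the quadratic form of the kernel; this form makes the parallelogram law and
  completeness immediate.\<close>

definition sqn :: "('a \<Rightarrow> real) \<Rightarrow> real" where
  "sqn f = (SUP c \<in> combos A. penalty f c)"

lemma rk_spaceI:
  assumes "\<And>x. x \<notin> A \<Longrightarrow> f x = 0" "\<And>c. c \<in> combos A \<Longrightarrow> penalty f c \<le> C"
  shows "f \<in> rk_space" "sqn f \<le> C"
proof -
  show "f \<in> rk_space" using assms by (auto simp: rk_space_def intro!: bdd_aboveI[of _ C])
  show "sqn f \<le> C" unfolding sqn_def by (rule cSUP_least) (use assms(2) combos_Nil[of A] in blast)+
qed

lemma rk_space_outside: "f \<in> rk_space \<Longrightarrow> x \<notin> A \<Longrightarrow> f x = 0"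
  by (simp add: rk_space_def)

lemma penalty_le: "\<lbrakk>f \<in> rk_space; c \<in> combos A\<rbrakk> \<Longrightarrow> penalty f c \<le> sqn f"
  unfolding sqn_def rk_space_def by (intro cSUP_upper) auto

lemma sqn_nonneg: "f \<in> rk_space \<Longrightarrow> 0 \<le> sqn f"
  using penalty_le[of f "[]"] by (simp add: penalty_def)

lemma zero_rk: "(\<lambda>x. 0) \<in> rk_space" and sqn_zero [simp]: "sqn (\<lambda>x. 0) = 0"
proof -
  have *: "penalty (\<lambda>x. 0) c \<le> 0" if "c \<in> combos A" for c
    using psd[OF that] by (simp add: penalty_def)
  show "(\<lambda>x. 0) \<in> rk_space" using rk_spaceI(1)[of "\<lambda>x. 0" 0] * by auto
  then show "sqn (\<lambda>x. 0) = 0" using rk_spaceI(2)[of "\<lambda>x. 0" 0] * sqn_nonneg by fastforce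
qed

lemma cmult_rk:
  assumes f: "f \<in> rk_space"
  shows "(\<lambda>x. r * f x) \<in> rk_space" and "sqn (\<lambda>x. r * f x) = r\<^sup>2 * sqn f"
proof -
  have *: "(\<lambda>x. r * g x) \<in> rk_space \<and> sqn (\<lambda>x. r * g x) \<le> r\<^sup>2 * sqn g"
    if g: "g \<in> rk_space" and "r \<noteq> 0" for g r
  proof -
    have "penalty (\<lambda>x. r * g x) c \<le> r\<^sup>2 * sqn g" if c: "c \<in> combos A" for c
    proof -
      have "penalty (\<lambda>x. r * g x) c = r\<^sup>2 * penalty g (scale (1 / r) c)"
        using \<open>r \<noteq> 0\<close> by (simp add: penalty_def pairing_cmult field_simps power2_eq_square)
      also have "\<dots> \<le> r\<^sup>2 * sqn g"
        by (intro mult_left_mono penalty_le g) (use c in auto)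
      finally show ?thesis .
    qed
    with rk_spaceI[of "\<lambda>x. r * g x"] rk_space_outside[OF g] show ?thesis by auto
  qed
  show "(\<lambda>x. r * f x) \<in> rk_space"
    by (cases "r = 0") (use * f zero_rk in auto)
  show "sqn (\<lambda>x. r * f x) = r\<^sup>2 * sqn f"
  proof (cases "r = 0")
    case False
    from *[OF f False] *[of "\<lambda>x. r * f x" "1 / r"] False
    have "sqn f \<le> (1 / r)\<^sup>2 * sqn (\<lambda>x. r * f x)" by simp
    then have "r\<^sup>2 * sqn f \<le> sqn (\<lambda>x. r * f x)"
      using False by (simp add: field_simps)
    with *[OF f False] show ?thesis by simp
  qed auto
qed

text \<open>The two suprema on the left range over independent \<open>c\<close> and
  \<open>d\<close>. The substitution \<open>u = (c + d) / 2\<close>, \<open>v = (c - d) / 2\<close>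
  turns the sum of the two penalties into twice the penalties of \<open>f\<close> at
  \<open>u\<close> and of \<open>g\<close> at \<open>v\<close>. Leaving \<open>c\<close> or
  \<open>d\<close> empty gives membership.\<close>

lemma parallelogram_le:
  assumes f: "f \<in> rk_space" and g: "g \<in> rk_space"
  shows "(\<lambda>x. f x + g x) \<in> rk_space" "(\<lambda>x. f x - g x) \<in> rk_space"
    and "sqn (\<lambda>x. f x + g x) + sqn (\<lambda>x. f x - g x) \<le> 2 * sqn f + 2 * sqn g"
proof -
  have *: "penalty (\<lambda>x. f x + g x) c + penalty (\<lambda>x. f x - g x) d \<le> 2 * sqn f + 2 * sqn g"
    if c: "c \<in> combos A" and d: "d \<in> combos A" for c d
  proof -
    define u v where "u = scale (1/2) c @ scale (1/2) d" and "v = scale (1/2) c @ scale (-1/2) d"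
    have uv: "u \<in> combos A" "v \<in> combos A" using c d by (auto simp: u_def v_def)
    have "penalty (\<lambda>x. f x + g x) c + penalty (\<lambda>x. f x - g x) d = 2 * penalty f u + 2 * penalty g v"
      by (simp add: penalty_def u_def v_def pairing_add pairing_diff kform_sym[OF d c] field_simps)
    then show ?thesis using penalty_le[OF f uv(1)] penalty_le[OF g uv(2)] by linarith
  qed
  have z: "penalty h [] = 0" for h by (simp add: penalty_def)
  show p: "(\<lambda>x. f x + g x) \<in> rk_space"
    by (rule rk_spaceI(1)[where C="2 * sqn f + 2 * sqn g"])
       (use *[of _ "[]"] z rk_space_outside[OF f] rk_space_outside[OF g] in auto)
  show m: "(\<lambda>x. f x - g x) \<in> rk_space"
    by (rule rk_spaceI(1)[where C="2 * sqn f + 2 * sqn g"])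
       (use *[of "[]"] z rk_space_outside[OF f] rk_space_outside[OF g] in auto)
  have "sqn (\<lambda>x. f x + g x) \<le> 2 * sqn f + 2 * sqn g - penalty (\<lambda>x. f x - g x) d"
    if "d \<in> combos A" for d
    by (rule rk_spaceI(2)) (use * that rk_space_outside[OF p] in \<open>auto simp: algebra_simps\<close>)
  then have "sqn (\<lambda>x. f x - g x) \<le> 2 * sqn f + 2 * sqn g - sqn (\<lambda>x. f x + g x)"
    by (intro rk_spaceI(2)) (use rk_space_outside[OF m] in \<open>auto simp: algebra_simps\<close>)
  then show "sqn (\<lambda>x. f x + g x) + sqn (\<lambda>x. f x - g x) \<le> 2 * sqn f + 2 * sqn g" by simp
qed

lemmas add_rk = parallelogram_le(1) and diff_rk = parallelogram_le(2)

text \<open>The reverse inequality is the same inequality applied to \<open>f + g\<close> and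
  \<open>f - g\<close>.\<close>

lemma parallelogram:
  assumes f: "f \<in> rk_space" and g: "g \<in> rk_space"
  shows "sqn (\<lambda>x. f x + g x) + sqn (\<lambda>x. f x - g x) = 2 * sqn f + 2 * sqn g"
proof (rule antisym[OF parallelogram_le(3)[OF f g]])
  have "sqn (\<lambda>x. 2 * f x) + sqn (\<lambda>x. 2 * g x)
      \<le> 2 * sqn (\<lambda>x. f x + g x) + 2 * sqn (\<lambda>x. f x - g x)"
    using parallelogram_le(3)[OF add_rk[OF f g] diff_rk[OF f g]] by (simp add: algebra_simps)
  then show "2 * sqn f + 2 * sqn g \<le> sqn (\<lambda>x. f x + g x) + sqn (\<lambda>x. f x - g x)"
    by (simp add: cmult_rk(2) f g)
qed

section \<open>The inner product, by the Jordan-von Neumann theorem\<close>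

definition rkip :: "('a \<Rightarrow> real) \<Rightarrow> ('a \<Rightarrow> real) \<Rightarrow> real" where
  "rkip f g = (sqn (\<lambda>x. f x + g x) - sqn f - sqn g) / 2"

lemma rkip_commute: "rkip f g = rkip g f"
  by (simp add: rkip_def add.commute)

lemma rkip_self: "f \<in> rk_space \<Longrightarrow> rkip f f = sqn f"
  using cmult_rk(2)[of f 2] by (simp add: rkip_def)

text \<open>Four parallelogram laws, for the pairs \<open>f + h, g\<close>, \<open>g + h, f\<close>,
  \<open>h, f - g\<close> and \<open>f, g\<close>; eliminating \<open>a\<close>, \<open>b\<close>
  and the norm of \<open>f - g\<close> leaves additivity.\<close>

lemma rkip_add_left:
  assumes f: "f \<in> rk_space" and g: "g \<in> rk_space" and h: "h \<in> rk_space"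
  shows "rkip (\<lambda>x. f x + g x) h = rkip f h + rkip g h"
proof -
  define T a b where "T = sqn (\<lambda>x. f x + g x + h x)" and "a = sqn (\<lambda>x. f x + h x - g x)"
    and "b = sqn (\<lambda>x. g x + h x - f x)"
  have "T + a = 2 * sqn (\<lambda>x. f x + h x) + 2 * sqn g"
    using parallelogram[OF add_rk[OF f h] g] by (simp add: T_def a_def add_ac)
  moreover have "T + b = 2 * sqn (\<lambda>x. g x + h x) + 2 * sqn f"
    using parallelogram[OF add_rk[OF g h] f] by (simp add: T_def b_def add_ac)
  moreover have "a + b = 2 * sqn h + 2 * sqn (\<lambda>x. f x - g x)"
    using parallelogram[OF h diff_rk[OF f g]] by (simp add: a_def b_def algebra_simps)
  moreover note parallelogram[OF f g]
  ultimately show ?thesis unfolding rkip_def T_def[symmetric] by argo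
qed

text \<open>The deviation \<open>h\<close> from homogeneity is additive in \<open>r\<close> and
  vanishes at the integers. Being bounded on the unit interval, it is bounded everywhere, and a
  bounded additive function is zero.\<close>

lemma rkip_cmult_left:
  assumes f: "f \<in> rk_space" and g: "g \<in> rk_space"
  shows "rkip (\<lambda>x. r * f x) g = r * rkip f g"
proof -
  define h where "h = (\<lambda>r. rkip (\<lambda>x. r * f x) g - r * rkip f g)"
  have add: "h (r + s) = h r + h s" for r s
    using rkip_add_left[OF cmult_rk(1)[OF f] cmult_rk(1)[OF f] g, of r s]
    by (simp add: h_def algebra_simps)
  have h1: "h 1 = 0" by (simp add: h_def)
  define C where "C = 2 * sqn f + 2 * sqn g + \<bar>rkip f g\<bar>"
  have bd: "\<bar>h r\<bar> \<le> C" if "0 \<le> r" "r \<le> 1" for r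
  proof -
    note rf = cmult_rk[OF f, of r]
    have r2: "r\<^sup>2 * sqn f \<le> 1 * sqn f"
      using that by (intro mult_right_mono sqn_nonneg[OF f]) (simp add: power_le_one)
    have "sqn (\<lambda>x. r * f x + g x) \<le> 2 * sqn f + 2 * sqn g"
      using parallelogram[OF rf(1) g] sqn_nonneg[OF diff_rk[OF rf(1) g]] r2 rf(2) by simp
    then have "\<bar>rkip (\<lambda>x. r * f x) g\<bar> \<le> 2 * sqn f + 2 * sqn g"
      using sqn_nonneg[OF f] sqn_nonneg[OF g] sqn_nonneg[OF rf(1)] r2 rf(2)
        sqn_nonneg[OF add_rk[OF rf(1) g]]
      unfolding rkip_def by argo
    moreover have "\<bar>r * rkip f g\<bar> \<le> 1 * \<bar>rkip f g\<bar>"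
      unfolding abs_mult using that by (intro mult_right_mono) auto
    ultimately show ?thesis by (simp add: h_def C_def)
  qed
  have nat: "h (real n * r) = real n * h r" for n r
  proof (induction n)
    case 0 show ?case using add[of 0 0] by simp
  next
    case (Suc n) then show ?case using add[of "real n * r" r] by (simp add: algebra_simps)
  qed
  have int: "h (of_int m) = 0" for m
  proof (cases m)
    case (nonneg n) then show ?thesis using nat[of n 1] h1 by simp
  next
    case (neg n)
    then show ?thesis using nat[of "Suc n" 1] h1 add[of "real (Suc n)" "- real (Suc n)"] nat[of 0 0]
      by (simp del: of_nat_Suc)
  qed
  have bd': "\<bar>h r\<bar> \<le> C" for r
  proof -
    have "h r = h (of_int \<lfloor>r\<rfloor>) + h (frac r)"
      using add[of "of_int \<lfloor>r\<rfloor>" "frac r"] by (simp add: frac_def)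
    then show ?thesis using int bd[of "frac r"] frac_lt_1[of r] by (simp add: less_imp_le)
  qed
  have "h r = 0"
  proof (rule ccontr)
    assume "h r \<noteq> 0"
    then obtain n where "C < real n * \<bar>h r\<bar>"
      using reals_Archimedean3[of "\<bar>h r\<bar>"] by auto
    then show False using bd'[of "real n * r"] nat[of n r] by (simp add: abs_mult)
  qed
  then show ?thesis by (simp add: h_def)
qed

text \<open>Cauchy-Schwarz for \<open>f\<close> and the kernel vector of \<open>c\<close>: scaling
  \<open>c\<close> by \<open>r\<close> bounds a quadratic polynomial in \<open>r\<close> by the
  squared norm, and its maximum is at \<open>r = p / q\<close>.\<close>

lemma pairing_sq_le:
  assumes f: "f \<in> rk_space" and c: "c \<in> combos A"
  shows "(pairing c f)\<^sup>2 \<le> sqn f * kform K c c"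
proof -
  define p q where "p = pairing c f" and "q = kform K c c"
  have le: "2 * r * p - r\<^sup>2 * q \<le> sqn f" for r
    using penalty_le[OF f combos_scale[OF c], of r]
    by (simp add: penalty_def p_def q_def power2_eq_square algebra_simps)
  have q: "0 \<le> q" using psd[OF c] by (simp add: q_def)
  show ?thesis
  proof (cases "q = 0")
    case True
    have "p = 0"
    proof (rule ccontr)
      assume "p \<noteq> 0"
      \<comment> \<open>For \<open>q = 0\<close> the bound is linear in \<open>r\<close>; this
        \<open>r\<close> makes its left side exceed the right side by 1.\<close>
      then show False using le[of "(sqn f + 1) / (2 * p)"] True by simp
    qed
    then show ?thesis using True by (simp add: p_def q_def)
  next
    case False
    then have "p\<^sup>2 / q \<le> sqn f" using le[of "p / q"] by (simp add: power2_eq_square)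
    then show ?thesis using False q by (simp add: p_def q_def field_simps)
  qed
qed

text \<open>Point evaluations are continuous. This is what makes the norm definite and norm-Cauchy
  sequences pointwise convergent.\<close>

lemma sq_le:
  assumes "f \<in> rk_space" "x \<in> A"
  shows "(f x)\<^sup>2 \<le> sqn f * K x x"
  using pairing_sq_le[OF assms(1), of "[(1, x)]"] assms(2) by (simp add: kform_def)

lemma sqn_eq_0D:
  assumes "f \<in> rk_space" "sqn f = 0"
  shows "f = (\<lambda>x. 0)"
proof
  show "f x = 0" for x
    using sq_le[of f x] rk_space_outside[of f x] assms by (cases "x \<in> A") auto
qed

text \<open>With \<open>s\<close> the sum of the two norms and \<open>q\<close> the norm of the
  kernel vector of \<open>c\<close>, Cauchy-Schwarz bounds the penalty of \<open>f + g\<close> by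
  \<open>2 s q - q^2\<close>, which is at most \<open>s^2\<close>.\<close>

lemma sqn_triangle:
  assumes f: "f \<in> rk_space" and g: "g \<in> rk_space"
  shows "sqrt (sqn (\<lambda>x. f x + g x)) \<le> sqrt (sqn f) + sqrt (sqn g)"
proof (rule real_le_lsqrt)
  let ?s = "sqrt (sqn f) + sqrt (sqn g)"
  show "0 \<le> ?s" using sqn_nonneg f g by simp
  show "sqn (\<lambda>x. f x + g x) \<le> ?s\<^sup>2"
  proof (rule rk_spaceI(2))
    show "f x + g x = 0" if "x \<notin> A" for x using that rk_space_outside[OF f] rk_space_outside[OF g] by simp
    fix c assume c: "c \<in> combos A"
    let ?q = "sqrt (kform K c c)"
    have 1: "pairing c h \<le> sqrt (sqn h) * ?q" if "h \<in> rk_space" for h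
      using pairing_sq_le[OF that c] unfolding real_sqrt_mult[symmetric] by (rule real_le_rsqrt)
    have "penalty (\<lambda>x. f x + g x) c \<le> 2 * (?s * ?q) - ?q\<^sup>2"
      using 1[OF f] 1[OF g] psd[OF c] by (simp add: penalty_def pairing_add algebra_simps)
    also have "\<dots> \<le> ?s\<^sup>2"
      using zero_le_power2[of "?s - ?q"] by (simp add: power2_eq_square algebra_simps)
    finally show "penalty (\<lambda>x. f x + g x) c \<le> ?s\<^sup>2" .
  qed
qed

text \<open>The limit is taken pointwise. Each penalty involves finitely many values only, so a
  bound on the penalties of \<open>F n - F m\<close> survives \<open>m\<close> tending to infinity,
  uniformly in \<open>c\<close>.\<close>

lemma rk_complete:
  fixes F :: "nat \<Rightarrow> 'a \<Rightarrow> real"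
  assumes F: "\<And>n. F n \<in> rk_space"
    and Cauchy: "\<And>e. 0 < e \<Longrightarrow> \<exists>N. \<forall>m\<ge>N. \<forall>n\<ge>N. sqn (\<lambda>x. F m x - F n x) < e"
  shows "\<exists>f \<in> rk_space. \<forall>e>0. \<exists>N. \<forall>n\<ge>N. sqn (\<lambda>x. F n x - f x) < e"
proof -
  have "Cauchy (\<lambda>n. F n x)" for x
  proof (cases "x \<in> A")
    case False then show ?thesis using rk_space_outside[OF F False] by (simp add: Cauchy_def)
  next
    case True
    have k: "0 \<le> K x x" using psd[of "[(1, x)]"] True by (simp add: kform_def)
    show ?thesis
    proof (rule metric_CauchyI)
      fix e :: real assume "0 < e"
      \<comment> \<open>Adding 1 to \<open>K x x\<close> keeps the quotient meaningful when the
        diagonal entry is zero.\<close>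
      then have "0 < e\<^sup>2 / (K x x + 1)" using k by simp
      from Cauchy[OF this] obtain N where
        N: "\<And>m n. m \<ge> N \<Longrightarrow> n \<ge> N \<Longrightarrow> sqn (\<lambda>x. F m x - F n x) < e\<^sup>2 / (K x x + 1)" by blast
      have "dist (F m x) (F n x) < e" if "m \<ge> N" "n \<ge> N" for m n
      proof -
        have "(F m x - F n x)\<^sup>2 \<le> sqn (\<lambda>x. F m x - F n x) * K x x"
          by (rule sq_le[OF diff_rk[OF F F] True])
        also have "\<dots> \<le> sqn (\<lambda>x. F m x - F n x) * (K x x + 1)"
          by (intro mult_left_mono sqn_nonneg diff_rk F) auto
        also have "\<dots> < e\<^sup>2" using N[OF that] k by (simp add: field_simps)
        finally show ?thesis
          using \<open>0 < e\<close> by (metis dist_real_def power2_abs power2_less_imp_less less_imp_le)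
      qed
      then show "\<exists>N. \<forall>m\<ge>N. \<forall>n\<ge>N. dist (F m x) (F n x) < e" by blast
    qed
  qed
  then have "\<forall>x. \<exists>l. (\<lambda>n. F n x) \<longlonglongrightarrow> l"
    using real_Cauchy_convergent by (auto simp: convergent_def)
  then obtain f where lim: "\<And>x. (\<lambda>n. F n x) \<longlonglongrightarrow> f x" by metis
  have f0: "f x = 0" if "x \<notin> A" for x
    using lim[of x] rk_space_outside[OF F that] by (simp add: LIMSEQ_const_iff)
  have key: "(\<lambda>x. F n x - f x) \<in> rk_space \<and> sqn (\<lambda>x. F n x - f x) \<le> e"
    if "n \<ge> N" and N: "\<forall>m\<ge>N. \<forall>n\<ge>N. sqn (\<lambda>x. F m x - F n x) < e" for n N e
  proof -
    have "penalty (\<lambda>x. F n x - f x) c \<le> e" if c: "c \<in> combos A" for c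
    proof (rule tendsto_upperbound)
      show "(\<lambda>m. penalty (\<lambda>x. F n x - F m x) c) \<longlonglongrightarrow> penalty (\<lambda>x. F n x - f x) c"
        unfolding penalty_def by (intro tendsto_intros tendsto_pairing lim)
      have "penalty (\<lambda>x. F n x - F m x) c \<le> e" if "m \<ge> N" for m
        using penalty_le[OF diff_rk[OF F F] c, of n m] N \<open>n \<ge> N\<close> that by force
      then show "\<forall>\<^sub>F m in sequentially. penalty (\<lambda>x. F n x - F m x) c \<le> e"
        by (auto simp: eventually_sequentially)
    qed simp
    then show ?thesis
      using rk_spaceI[of "\<lambda>x. F n x - f x" e] f0 rk_space_outside[OF F] by auto
  qed
  obtain N where "\<forall>m\<ge>N. \<forall>n\<ge>N. sqn (\<lambda>x. F m x - F n x) < 1" using Cauchy[of 1] by auto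
  with key[of N N 1] have "(\<lambda>x. F N x - f x) \<in> rk_space" by blast
  \<comment> \<open>The limit is recovered as \<open>F N - (F N - f)\<close>.\<close>
  from diff_rk[OF F[of N] this] have "f \<in> rk_space" by simp
  moreover have "\<exists>N. \<forall>n\<ge>N. sqn (\<lambda>x. F n x - f x) < e" if e: "0 < e" for e
  proof -
    obtain N where "\<forall>m\<ge>N. \<forall>n\<ge>N. sqn (\<lambda>x. F m x - F n x) < e / 2" using Cauchy[of "e / 2"] e by auto
    then show ?thesis using key[of N _ "e / 2"] e by fastforce
  qed
  ultimately show ?thesis by blast
qed

definition kvec :: "(real \<times> 'a) list \<Rightarrow> 'a \<Rightarrow> real" where
  "kvec d x = (if x \<in> A then pairing d (K x) else 0)"

text \<open>Positivity of \<open>K\<close> at \<open>c - d\<close> says that the penalty of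
  \<open>kvec d\<close> at \<open>c\<close> is at most \<open>kform K d d\<close>, and
  \<open>c = d\<close> attains this bound.\<close>

lemma kvec_rk:
  assumes d: "d \<in> combos A"
  shows "kvec d \<in> rk_space" and "sqn (kvec d) = kform K d d"
proof -
  have p: "pairing c (kvec d) = kform K c d" if "c \<in> combos A" for c
    unfolding kform_def using that by (intro pairing_cong) (auto simp: kvec_def combos_def)
  have le: "penalty (kvec d) c \<le> kform K d d" if c: "c \<in> combos A" for c
    using psd[of "c @ scale (-1) d"] c d p[OF c]
    by (simp add: penalty_def kform_sym[OF d c])
  have 0: "kvec d x = 0" if "x \<notin> A" for x using that by (simp add: kvec_def)
  show "kvec d \<in> rk_space" by (rule rk_spaceI(1)[OF 0 le])
  then have "penalty (kvec d) d \<le> sqn (kvec d)" by (rule penalty_le[OF _ d])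
  then show "sqn (kvec d) = kform K d d"
    using rk_spaceI(2)[OF 0 le] by (simp add: penalty_def p[OF d])
qed

end

section \<open>Kernels on groups with property (T)\<close>

lemma cring_complex_ring: "cring complex_ring"
proof (rule cringI)
  show "abelian_group complex_ring"
    by (rule abelian_groupI) (auto simp: complex_ring_def algebra_simps intro: exI[of _ "- x" for x])
  show "comm_monoid complex_ring"
    by (rule comm_monoidI) (auto simp: complex_ring_def)
qed (auto simp: complex_ring_def algebra_simps)

section \<open>Complexification of the real space\<close>

context psd_kernel
begin

definition rk_carrier :: "('a \<Rightarrow> complex) set" where
  "rk_carrier = {f. (\<lambda>x. Re (f x)) \<in> rk_space \<and> (\<lambda>x. Im (f x)) \<in> rk_space}"

text \<open>The signs are those of the extension to \<open>u + iv\<close> and \<open>a + ib\<close>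
  that is linear in the first argument, the convention of
  \<open>complex_hilbert_space\<close>.\<close>

definition rk_cinner :: "('a \<Rightarrow> complex) \<Rightarrow> ('a \<Rightarrow> complex) \<Rightarrow> complex" where
  "rk_cinner f g = Complex
     (rkip (\<lambda>x. Re (f x)) (\<lambda>x. Re (g x)) + rkip (\<lambda>x. Im (f x)) (\<lambda>x. Im (g x)))
     (rkip (\<lambda>x. Im (f x)) (\<lambda>x. Re (g x)) - rkip (\<lambda>x. Re (f x)) (\<lambda>x. Im (g x)))"

definition trunc :: "('a \<Rightarrow> complex) \<Rightarrow> 'a \<Rightarrow> complex" where
  "trunc f = (if f \<in> rk_carrier then f else (\<lambda>x. 0))"

text \<open>\<open>Metric_space\<close> demands nonnegativity and symmetry of the distance also outside the carrier,
  so the addition treats vectors outside the carrier as zero.\<close>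

definition rk_hilbert :: "('a \<Rightarrow> complex) inner_product_module" where
  "rk_hilbert = \<lparr>carrier = rk_carrier, mult = (\<lambda>f g. f), one = (\<lambda>x. 0), zero = (\<lambda>x. 0),
     add = (\<lambda>f g x. trunc f x + trunc g x), smult = (\<lambda>a f x. a * f x), cinner = rk_cinner\<rparr>"

lemma rk_hilbert_simps [simp]:
  "carrier rk_hilbert = rk_carrier" "\<zero>\<^bsub>rk_hilbert\<^esub> = (\<lambda>x. 0)"
  "a \<odot>\<^bsub>rk_hilbert\<^esub> f = (\<lambda>x. a * f x)" "cinner rk_hilbert = rk_cinner"
  by (simp_all add: rk_hilbert_def)

lemma rk_hilbert_add: "f \<oplus>\<^bsub>rk_hilbert\<^esub> g = (\<lambda>x. trunc f x + trunc g x)"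
  by (simp add: rk_hilbert_def)

lemma trunc_in: "f \<in> rk_carrier \<Longrightarrow> trunc f = f"
  by (simp add: trunc_def)

lemma zero_carrier: "(\<lambda>x. 0) \<in> rk_carrier"
  using zero_rk by (simp add: rk_carrier_def)

lemma trunc_carrier: "trunc f \<in> rk_carrier"
  using zero_carrier by (simp add: trunc_def)

lemma add_carrier: "f \<in> rk_carrier \<Longrightarrow> g \<in> rk_carrier \<Longrightarrow> (\<lambda>x. f x + g x) \<in> rk_carrier"
  by (auto simp: rk_carrier_def intro: add_rk)

lemma diff_carrier: "f \<in> rk_carrier \<Longrightarrow> g \<in> rk_carrier \<Longrightarrow> (\<lambda>x. f x - g x) \<in> rk_carrier"
  by (auto simp: rk_carrier_def intro: diff_rk)

lemma smult_carrier: "f \<in> rk_carrier \<Longrightarrow> (\<lambda>x. a * f x) \<in> rk_carrier"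
  by (auto simp: rk_carrier_def intro!: add_rk diff_rk cmult_rk)

lemma abelian_group_rk: "abelian_group rk_hilbert"
proof (rule abelian_groupI)
  show "\<exists>y\<in>carrier rk_hilbert. y \<oplus>\<^bsub>rk_hilbert\<^esub> f = \<zero>\<^bsub>rk_hilbert\<^esub>"
    if "f \<in> carrier rk_hilbert" for f
    using that smult_carrier[of f "-1"]
    by (intro bexI[of _ "\<lambda>x. - f x"]) (auto simp: rk_hilbert_add trunc_in)
qed (auto simp: rk_hilbert_add trunc_in add_carrier zero_carrier algebra_simps)

text \<open>The inverse is a definite description, and the metric axioms require its value also at
  \<open>f\<close> outside the carrier. Such an \<open>f\<close> acts as zero under the addition, so
  its inverse still exists and is unique.\<close>

lemma rk_a_inv: "\<ominus>\<^bsub>rk_hilbert\<^esub> f = (\<lambda>x. - trunc f x)"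
proof -
  have m: "(\<lambda>x. - trunc f x) \<in> rk_carrier"
    using smult_carrier[OF trunc_carrier, of "-1"] by simp
  show ?thesis
    unfolding a_inv_def m_inv_def
  proof (rule the_equality)
    show "(\<lambda>x. - trunc f x) \<in> carrier (add_monoid rk_hilbert) \<and>
      f \<otimes>\<^bsub>add_monoid rk_hilbert\<^esub> (\<lambda>x. - trunc f x) = \<one>\<^bsub>add_monoid rk_hilbert\<^esub> \<and>
      (\<lambda>x. - trunc f x) \<otimes>\<^bsub>add_monoid rk_hilbert\<^esub> f = \<one>\<^bsub>add_monoid rk_hilbert\<^esub>"
      using m by (simp add: rk_hilbert_add trunc_in[OF m])
    fix y assume "y \<in> carrier (add_monoid rk_hilbert) \<and>
      f \<otimes>\<^bsub>add_monoid rk_hilbert\<^esub> y = \<one>\<^bsub>add_monoid rk_hilbert\<^esub> \<and>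
      y \<otimes>\<^bsub>add_monoid rk_hilbert\<^esub> f = \<one>\<^bsub>add_monoid rk_hilbert\<^esub>"
    then have "y \<in> rk_carrier" "(\<lambda>x. trunc y x + trunc f x) = (\<lambda>x. 0)"
      by (auto simp: rk_hilbert_add)
    then show "y = (\<lambda>x. - trunc f x)"
      by (auto simp: trunc_in fun_eq_iff eq_neg_iff_add_eq_0)
  qed
qed

lemma rk_minus: "f \<ominus>\<^bsub>rk_hilbert\<^esub> g = (\<lambda>x. trunc f x - trunc g x)"
proof -
  have "(\<lambda>x. - trunc g x) \<in> rk_carrier"
    using smult_carrier[OF trunc_carrier, of "-1"] by simp
  then show ?thesis by (simp add: a_minus_def rk_a_inv rk_hilbert_add trunc_in)
qed

lemma hnorm_rk:
  "f \<in> rk_carrier \<Longrightarrow> hnorm rk_hilbert f = sqrt (sqn (\<lambda>x. Re (f x)) + sqn (\<lambda>x. Im (f x)))"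
  by (simp add: hnorm_def rk_cinner_def rkip_self rk_carrier_def)

lemma rk_cinner_self_nonneg: "f \<in> rk_carrier \<Longrightarrow> 0 \<le> Re (rk_cinner f f)"
  by (simp add: rk_cinner_def rkip_self rk_carrier_def sqn_nonneg)

lemma rk_cinner_self_eq_0:
  assumes f: "f \<in> rk_carrier" and "Re (rk_cinner f f) = 0"
  shows "f = (\<lambda>x. 0)"
proof -
  have "sqn (\<lambda>x. Re (f x)) = 0" "sqn (\<lambda>x. Im (f x)) = 0"
    using assms sqn_nonneg[of "\<lambda>x. Re (f x)"] sqn_nonneg[of "\<lambda>x. Im (f x)"]
    by (simp_all add: rk_cinner_def rkip_self rk_carrier_def add_nonneg_eq_0_iff)
  then have "(\<lambda>x. Re (f x)) = (\<lambda>x. 0)" "(\<lambda>x. Im (f x)) = (\<lambda>x. 0)"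
    using f by (auto simp: rk_carrier_def intro!: sqn_eq_0D)
  then show ?thesis by (auto simp: fun_eq_iff complex_eq_iff)
qed

text \<open>The norm is the Euclidean norm of the pair of real norms, so the real triangle
  inequalities combine with the one in the plane.\<close>

lemma hnorm_triangle:
  assumes f: "f \<in> rk_carrier" and g: "g \<in> rk_carrier"
  shows "hnorm rk_hilbert (\<lambda>x. f x + g x) \<le> hnorm rk_hilbert f + hnorm rk_hilbert g"
proof -
  let ?a = "sqrt (sqn (\<lambda>x. Re (f x)))" and ?b = "sqrt (sqn (\<lambda>x. Im (f x)))"
  let ?c = "sqrt (sqn (\<lambda>x. Re (g x)))" and ?d = "sqrt (sqn (\<lambda>x. Im (g x)))"
  let ?u = "sqn (\<lambda>x. Re (f x) + Re (g x))" and ?v = "sqn (\<lambda>x. Im (f x) + Im (g x))"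
  have rf: "(\<lambda>x. Re (f x)) \<in> rk_space" "(\<lambda>x. Im (f x)) \<in> rk_space"
    "(\<lambda>x. Re (g x)) \<in> rk_space" "(\<lambda>x. Im (g x)) \<in> rk_space"
    using f g by (auto simp: rk_carrier_def)
  note nn = rf[THEN sqn_nonneg] sqn_nonneg[OF add_rk[OF rf(1,3)]] sqn_nonneg[OF add_rk[OF rf(2,4)]]
  have "?u \<le> (?a + ?c)\<^sup>2" "?v \<le> (?b + ?d)\<^sup>2"
    using sqn_triangle[OF rf(1,3)] sqn_triangle[OF rf(2,4)]
    by (auto intro: sqrt_le_D)
  then have "sqrt (?u + ?v) \<le> sqrt ((?a + ?c)\<^sup>2 + (?b + ?d)\<^sup>2)" by simp
  also have "\<dots> \<le> sqrt (?a\<^sup>2 + ?b\<^sup>2) + sqrt (?c\<^sup>2 + ?d\<^sup>2)"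
    by (rule real_sqrt_sum_squares_triangle_ineq)
  finally show ?thesis using nn by (simp add: hnorm_rk f g add_carrier)
qed

lemma rk_metric: "Metric_space rk_carrier (\<lambda>f g. hnorm rk_hilbert (f \<ominus>\<^bsub>rk_hilbert\<^esub> g))"
proof
  fix f g h :: "'a \<Rightarrow> complex"
  have d: "(\<lambda>x. trunc f x - trunc g x) \<in> rk_carrier" for f g
    by (intro diff_carrier trunc_carrier)
  show "0 \<le> hnorm rk_hilbert (f \<ominus>\<^bsub>rk_hilbert\<^esub> g)"
    unfolding rk_minus using d rk_cinner_self_nonneg by (simp add: hnorm_def)
  have "rk_cinner (\<lambda>x. -1 * p x) (\<lambda>x. -1 * p x) = rk_cinner p p" if "p \<in> rk_carrier" for p
  proof -
    have *: "rkip (\<lambda>x. -1 * a x) (\<lambda>x. -1 * b x) = rkip a b" if "a \<in> rk_space" "b \<in> rk_space" for a b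
      using that cmult_rk(1)[of _ "-1"] 
      by (metis rkip_cmult_left rkip_commute minus_mult_minus mult.assoc mult_1)
    show ?thesis using that *
      by (auto simp: rk_cinner_def rk_carrier_def)
  qed
  from this[OF d[of f g]]
  show "hnorm rk_hilbert (f \<ominus>\<^bsub>rk_hilbert\<^esub> g) = hnorm rk_hilbert (g \<ominus>\<^bsub>rk_hilbert\<^esub> f)"
    by (simp add: rk_minus hnorm_def)
  show "hnorm rk_hilbert (f \<ominus>\<^bsub>rk_hilbert\<^esub> g) = 0 \<longleftrightarrow> f = g"
    if "f \<in> rk_carrier" "g \<in> rk_carrier"
  proof -
    have "rk_cinner (\<lambda>x. 0) (\<lambda>x. 0) = 0" by (simp add: rk_cinner_def rkip_def complex_eq_iff)
    then have "Re (rk_cinner p p) = 0 \<longleftrightarrow> p = (\<lambda>x. 0)" if "p \<in> rk_carrier" for p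
      using rk_cinner_self_eq_0[OF that] by auto
    from this[OF d[of f g]] that show ?thesis
      by (simp add: rk_minus hnorm_def trunc_in fun_eq_iff)
  qed
  show "hnorm rk_hilbert (f \<ominus>\<^bsub>rk_hilbert\<^esub> h)
      \<le> hnorm rk_hilbert (f \<ominus>\<^bsub>rk_hilbert\<^esub> g) + hnorm rk_hilbert (g \<ominus>\<^bsub>rk_hilbert\<^esub> h)"
    using hnorm_triangle[OF d[of f g] d[of g h]] by (simp add: rk_minus)
qed

lemma rk_mcomplete:
  "Metric_space.mcomplete rk_carrier (\<lambda>f g. hnorm rk_hilbert (f \<ominus>\<^bsub>rk_hilbert\<^esub> g))"
proof -
  interpret M: Metric_space rk_carrier "\<lambda>f g. hnorm rk_hilbert (f \<ominus>\<^bsub>rk_hilbert\<^esub> g)"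
    by (rule rk_metric)
  show ?thesis
    unfolding M.mcomplete_def
  proof (intro allI impI)
    fix F :: "nat \<Rightarrow> 'a \<Rightarrow> complex" assume C: "M.MCauchy F"
    then have F: "F n \<in> rk_carrier" for n by (auto simp: M.MCauchy_def)
    have hm: "hnorm rk_hilbert (f \<ominus>\<^bsub>rk_hilbert\<^esub> g)
        = sqrt (sqn (\<lambda>x. Re (f x) - Re (g x)) + sqn (\<lambda>x. Im (f x) - Im (g x)))"
      if "f \<in> rk_carrier" "g \<in> rk_carrier" for f g
      using that hnorm_rk[OF diff_carrier[OF that]] by (simp add: rk_minus trunc_in)
    have R: "(\<lambda>x. Re (F n x)) \<in> rk_space" "(\<lambda>x. Im (F n x)) \<in> rk_space" for n
      using F[of n] by (auto simp: rk_carrier_def)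
    have both: "\<exists>N. \<forall>m\<ge>N. \<forall>n\<ge>N. sqn (\<lambda>x. Re (F m x) - Re (F n x)) < e \<and>
        sqn (\<lambda>x. Im (F m x) - Im (F n x)) < e" if "0 < e" for e
    proof -
      from that have "0 < sqrt e" by simp
      with C obtain N where "\<And>m n. N \<le> m \<Longrightarrow> N \<le> n \<Longrightarrow>
          hnorm rk_hilbert (F m \<ominus>\<^bsub>rk_hilbert\<^esub> F n) < sqrt e"
        unfolding M.MCauchy_def by metis
      then have N: "sqn (\<lambda>x. Re (F m x) - Re (F n x)) + sqn (\<lambda>x. Im (F m x) - Im (F n x)) < e"
        if "N \<le> m" "N \<le> n" for m n
        using that by (simp add: hm F)
      have "sqn (\<lambda>x. Re (F m x) - Re (F n x)) < e \<and> sqn (\<lambda>x. Im (F m x) - Im (F n x)) < e"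
        if "N \<le> m" "N \<le> n" for m n
        using N[OF that] sqn_nonneg[OF diff_rk[OF R(1) R(1), of m n]]
          sqn_nonneg[OF diff_rk[OF R(2) R(2), of m n]] by linarith
      then show ?thesis by blast
    qed
    obtain u where u: "u \<in> rk_space" "\<And>e. 0 < e \<Longrightarrow> \<exists>N. \<forall>n\<ge>N. sqn (\<lambda>x. Re (F n x) - u x) < e"
      using rk_complete[of "\<lambda>n x. Re (F n x)"] R(1) both by metis
    obtain v where v: "v \<in> rk_space" "\<And>e. 0 < e \<Longrightarrow> \<exists>N. \<forall>n\<ge>N. sqn (\<lambda>x. Im (F n x) - v x) < e"
      using rk_complete[of "\<lambda>n x. Im (F n x)"] R(2) both by metis
    define f where "f = (\<lambda>x. Complex (u x) (v x))"
    have f: "f \<in> rk_carrier" using u v by (simp add: f_def rk_carrier_def)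
    have "\<forall>\<^sub>F n in sequentially. hnorm rk_hilbert (F n \<ominus>\<^bsub>rk_hilbert\<^esub> f) < e" if "0 < e" for e
    proof -
      have e: "0 < e\<^sup>2 / 2" using that by simp
      obtain N where N: "\<forall>n\<ge>N. sqn (\<lambda>x. Re (F n x) - u x) < e\<^sup>2 / 2" using u(2)[OF e] by blast
      obtain N' where N': "\<forall>n\<ge>N'. sqn (\<lambda>x. Im (F n x) - v x) < e\<^sup>2 / 2" using v(2)[OF e] by blast
      have "hnorm rk_hilbert (F n \<ominus>\<^bsub>rk_hilbert\<^esub> f) < e" if "max N N' \<le> n" for n
      proof -
        have "sqn (\<lambda>x. Re (F n x) - u x) < e\<^sup>2 / 2" "sqn (\<lambda>x. Im (F n x) - v x) < e\<^sup>2 / 2"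
          using that N N' by auto
        then have "sqn (\<lambda>x. Re (F n x) - u x) + sqn (\<lambda>x. Im (F n x) - v x) < e\<^sup>2" by linarith
        then show ?thesis using \<open>0 < e\<close> by (simp add: hm F f) (simp add: f_def real_less_lsqrt)
      qed
      then show ?thesis unfolding eventually_sequentially by blast
    qed
    then show "\<exists>f. limitin M.mtopology F f sequentially"
      using F f by (intro exI[of _ f]) (simp add: M.limitin_metric)
  qed
qed

lemma rkip_diff_left:
  assumes "f \<in> rk_space" "g \<in> rk_space" "h \<in> rk_space"
  shows "rkip (\<lambda>x. f x - g x) h = rkip f h - rkip g h"
  using rkip_add_left[OF assms(1) cmult_rk(1)[OF assms(2), of "-1"] assms(3)]
    rkip_cmult_left[OF assms(2,3), of "-1"] by simp

lemma complex_hilbert_space_rk: "complex_hilbert_space rk_hilbert"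
proof (intro complex_hilbert_space.intro complex_hilbert_space_axioms.intro)
  show "Module.module complex_ring rk_hilbert"
    by (rule moduleI[OF cring_complex_ring abelian_group_rk])
       (auto simp: complex_ring_def rk_hilbert_add trunc_in smult_carrier algebra_simps)
next
  fix f g h assume "f \<in> carrier rk_hilbert" "g \<in> carrier rk_hilbert" "h \<in> carrier rk_hilbert"
  then show "cinner rk_hilbert (f \<oplus>\<^bsub>rk_hilbert\<^esub> g) h = cinner rk_hilbert f h + cinner rk_hilbert g h"
    by (simp add: rk_hilbert_add trunc_in rk_cinner_def rk_carrier_def rkip_add_left complex_eq_iff)
next
  fix f g a assume "f \<in> carrier rk_hilbert" "g \<in> carrier rk_hilbert"
  then show "cinner rk_hilbert (a \<odot>\<^bsub>rk_hilbert\<^esub> f) g = a * cinner rk_hilbert f g"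
    by (simp add: rk_cinner_def rk_carrier_def complex_eq_iff rkip_add_left rkip_diff_left
        rkip_cmult_left cmult_rk(1) algebra_simps)
next
  fix f g assume "f \<in> carrier rk_hilbert" "g \<in> carrier rk_hilbert"
  show "cinner rk_hilbert f g = cnj (cinner rk_hilbert g f)"
    by (simp add: rk_cinner_def complex_eq_iff rkip_commute)
qed (use rk_cinner_self_nonneg rk_cinner_self_eq_0 rk_mcomplete in auto)

end

section \<open>The unitary representation of a left-invariant kernel\<close>

locale invariant_kernel = group G + psd_kernel "carrier G" K
  for G :: "'a monoid" (structure) and K +
  assumes invariant:
    "\<lbrakk>g \<in> carrier G; x \<in> carrier G; y \<in> carrier G\<rbrakk> \<Longrightarrow> K (g \<otimes> x) (g \<otimes> y) = K x y"
begin

text \<open>Left translation, cut off outside the carrier so that it preserves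
  \<open>rk_space\<close>. It is polymorphic in the values to serve real and complex functions
  alike.\<close>

definition transl :: "'a \<Rightarrow> ('a \<Rightarrow> 'b::zero) \<Rightarrow> 'a \<Rightarrow> 'b" where
  "transl g f x = (if x \<in> carrier G then f (inv g \<otimes> x) else 0)"

lemma transl_transl:
  assumes "g \<in> carrier G" "h \<in> carrier G"
  shows "transl g (transl h f) = transl (g \<otimes> h) f"
  using assms by (auto simp: transl_def fun_eq_iff inv_mult_group m_assoc)

lemma transl_one:
  assumes "\<And>x. x \<notin> carrier G \<Longrightarrow> f x = 0"
  shows "transl \<one> f = f"
  using assms by (auto simp: transl_def fun_eq_iff)

text \<open>Invariance of \<open>K\<close> moves the translation from the function to the points of
  the combination without changing the quadratic form. This gives one inequality, and the
  translation by the inverse gives the other.\<close>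

lemma transl_rk:
  assumes f: "f \<in> rk_space" and g: "g \<in> carrier G"
  shows "transl g f \<in> rk_space" and "sqn (transl g f) = sqn f"
proof -
  have *: "transl g f \<in> rk_space \<and> sqn (transl g f) \<le> sqn f"
    if f: "f \<in> rk_space" and g: "g \<in> carrier G" for f g
  proof -
    have "penalty (transl g f) c \<le> sqn f" if c: "c \<in> combos (carrier G)" for c
    proof -
      let ?c = "map (\<lambda>(a, x). (a, inv g \<otimes> x)) c"
      have "kform K ?c ?c = kform K c c"
        unfolding kform_map using c g by (intro kform_cong) (auto simp: combos_def intro!: invariant)
      moreover have "pairing c (transl g f) = pairing ?c f"
        unfolding pairing_map using c by (intro pairing_cong) (auto simp: combos_def transl_def)
      moreover have "?c \<in> combos (carrier G)" using c g by (auto simp: combos_def)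
      ultimately show ?thesis using penalty_le[OF f, of ?c] by (simp add: penalty_def)
    qed
    then show ?thesis using rk_spaceI[of "transl g f" "sqn f"] by (auto simp: transl_def)
  qed
  show "transl g f \<in> rk_space" using *[OF f g] by simp
  have "transl (inv g) (transl g f) = f"
    using g transl_one[of f] rk_space_outside[OF f] by (simp add: transl_transl)
  then show "sqn (transl g f) = sqn f"
    using *[OF f g] *[of "transl g f" "inv g"] g by fastforce
qed

lemma rkip_transl:
  assumes f: "f \<in> rk_space" and h: "h \<in> rk_space" and g: "g \<in> carrier G"
  shows "rkip (transl g f) (transl g h) = rkip f h"
proof -
  have "(\<lambda>x. transl g f x + transl g h x) = transl g (\<lambda>x. f x + h x)"
    by (auto simp: transl_def)
  then show ?thesis by (simp add: rkip_def transl_rk add_rk assms)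
qed

lemma transl_carrier:
  assumes "f \<in> rk_carrier" "g \<in> carrier G"
  shows "transl g f \<in> rk_carrier"
proof -
  have "(\<lambda>x. Re (transl g f x)) = transl g (\<lambda>x. Re (f x))"
    "(\<lambda>x. Im (transl g f x)) = transl g (\<lambda>x. Im (f x))" by (auto simp: transl_def)
  then show ?thesis using assms by (simp add: rk_carrier_def transl_rk)
qed

lemma rk_carrier_outside: "f \<in> rk_carrier \<Longrightarrow> x \<notin> carrier G \<Longrightarrow> f x = 0"
  using rk_space_outside[of "\<lambda>x. Re (f x)" x] rk_space_outside[of "\<lambda>x. Im (f x)" x]
  by (auto simp: rk_carrier_def complex_eq_iff)

text \<open>\<open>BijGroup\<close> consists of extensional maps, hence the restriction.\<close>

definition rk_rep :: "'a \<Rightarrow> ('a \<Rightarrow> complex) \<Rightarrow> 'a \<Rightarrow> complex" where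
  "rk_rep g = restrict (transl g) rk_carrier"

lemma rk_rep_group_action: "group_action G rk_carrier rk_rep"
proof -
  have inv: "transl (inv g) (transl g f) = f" "transl g (transl (inv g) f) = f"
    if "f \<in> rk_carrier" "g \<in> carrier G" for f g
    using that transl_one[of f] rk_carrier_outside[of f] by (simp_all add: transl_transl)
  have bij: "rk_rep g \<in> Bij rk_carrier" if g: "g \<in> carrier G" for g
  proof -
    have "bij_betw (rk_rep g) rk_carrier rk_carrier"
      by (rule bij_betw_byWitness[where f'="transl (inv g)"])
         (use g inv transl_carrier in \<open>auto simp: rk_rep_def\<close>)
    then show ?thesis by (simp add: Bij_def rk_rep_def)
  qed
  have "rk_rep \<in> hom G (BijGroup rk_carrier)"
  proof (rule homI)
    fix g h assume g: "g \<in> carrier G" and h: "h \<in> carrier G"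
    have "rk_rep (g \<otimes> h) = compose rk_carrier (rk_rep g) (rk_rep h)"
      using g h by (auto simp: rk_rep_def compose_def transl_transl transl_carrier fun_eq_iff)
    then show "rk_rep (g \<otimes> h) = rk_rep g \<otimes>\<^bsub>BijGroup rk_carrier\<^esub> rk_rep h"
      using bij[OF g] bij[OF h] by (simp add: BijGroup_def)
  qed (use bij in \<open>simp add: BijGroup_def\<close>)
  then show ?thesis
    by (intro group_action.intro group_hom.intro group_hom_axioms.intro group_axioms group_BijGroup)
qed

lemma rk_rep_unitary: "unitary_representation G rk_hilbert rk_rep"
  unfolding unitary_representation_def
proof (intro conjI ballI allI)
  show "group_action G (carrier rk_hilbert) rk_rep" using rk_rep_group_action by simp
  fix g f h a
  assume "g \<in> carrier G" "f \<in> carrier rk_hilbert" "h \<in> carrier rk_hilbert"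
  then have g: "g \<in> carrier G" and f: "f \<in> rk_carrier" and h: "h \<in> rk_carrier" by auto
  have ri: "(\<lambda>x. Re (transl g f x)) = transl g (\<lambda>x. Re (f x))"
    "(\<lambda>x. Im (transl g f x)) = transl g (\<lambda>x. Im (f x))" for f :: "'a \<Rightarrow> complex"
    by (auto simp: transl_def)
  show "rk_rep g (f \<oplus>\<^bsub>rk_hilbert\<^esub> h) = rk_rep g f \<oplus>\<^bsub>rk_hilbert\<^esub> rk_rep g h"
    using f g h by (simp add: rk_rep_def rk_hilbert_add trunc_in transl_carrier add_carrier)
      (simp add: transl_def fun_eq_iff)
  show "rk_rep g (a \<odot>\<^bsub>rk_hilbert\<^esub> f) = a \<odot>\<^bsub>rk_hilbert\<^esub> rk_rep g f"
    using f g by (simp add: rk_rep_def smult_carrier) (simp add: transl_def fun_eq_iff)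
  show "cinner rk_hilbert (rk_rep g f) (rk_rep g h) = cinner rk_hilbert f h"
    using f g h by (simp add: rk_rep_def rk_cinner_def ri rkip_transl rk_carrier_def)
qed (rule complex_hilbert_space_rk)

lemma real_kvec_carrier:
  assumes "d \<in> combos (carrier G)"
  shows "(\<lambda>x. complex_of_real (kvec d x)) \<in> rk_carrier"
    and "hnorm rk_hilbert (\<lambda>x. complex_of_real (kvec d x)) = sqrt (kform K d d)"
proof -
  show *: "(\<lambda>x. complex_of_real (kvec d x)) \<in> rk_carrier"
    using kvec_rk[OF assms] zero_rk by (simp add: rk_carrier_def)
  show "hnorm rk_hilbert (\<lambda>x. complex_of_real (kvec d x)) = sqrt (kform K d d)"
    using kvec_rk[OF assms] by (simp add: hnorm_rk[OF *])
qed

text \<open>The kernel vector at the identity is moved to the one at \<open>g\<close>. Thus the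
  representation has matrix coefficient \<open>K g \<one>\<close> at that vector; it plays the part
  of the GNS representation of the positive definite function sending \<open>g\<close> to
  \<open>K g \<one>\<close>.\<close>

lemma rk_rep_kvec:
  assumes g: "g \<in> carrier G"
  shows "rk_rep g (\<lambda>x. complex_of_real (kvec [(1, \<one>)] x)) = (\<lambda>x. complex_of_real (kvec [(1, g)] x))"
proof -
  have "K \<one> (inv g \<otimes> x) = K g x" if "x \<in> carrier G" for x
    using invariant[of "inv g" g x] g that by simp
  then have "K (inv g \<otimes> x) \<one> = K x g" if "x \<in> carrier G" for x
    using that g sym[of x g] sym[of "inv g \<otimes> x" \<one>] by simp
  then show ?thesis
    using real_kvec_carrier(1)[of "[(1, \<one>)]"] g
    by (auto simp: rk_rep_def transl_def kvec_def fun_eq_iff)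
qed

text \<open>An invariant function is constant on the group. A nonzero constant in the space forces
  \<open>K\<close> to dominate a positive multiple of the constant kernel, by Cauchy-Schwarz against
  all combinations.\<close>

lemma rk_rep_invariant_vector:
  assumes f: "f \<in> rk_carrier" and "f \<noteq> (\<lambda>x. 0)" and inv: "\<And>g. g \<in> carrier G \<Longrightarrow> rk_rep g f = f"
  shows "\<exists>\<delta>>0. \<forall>c \<in> combos (carrier G). \<delta> * (pairing c (\<lambda>x. 1))\<^sup>2 \<le> kform K c c"
proof -
  have const: "f x = f \<one>" if x: "x \<in> carrier G" for x
  proof -
    have "transl x f x = f x" using inv[OF x] f by (simp add: rk_rep_def)
    then show ?thesis using x by (simp add: transl_def)
  qed
  obtain y where "f y \<noteq> 0" using assms(2) by auto
  then have "f \<one> \<noteq> 0" using const[of y] rk_carrier_outside[OF f, of y] by metis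
  \<comment> \<open>The constant value is complex; its real or its imaginary part is a nonzero
    constant in the real space.\<close>
  obtain p where p: "p \<in> rk_space" and p1: "p \<one> \<noteq> 0" and pc: "\<And>x. x \<in> carrier G \<Longrightarrow> p x = p \<one>"
  proof (cases "Re (f \<one>) = 0")
    case True
    then have "Im (f \<one>) \<noteq> 0" using \<open>f \<one> \<noteq> 0\<close> by (simp add: complex_eq_iff)
    moreover have "(\<lambda>x. Im (f x)) \<in> rk_space" using f by (simp add: rk_carrier_def)
    ultimately show ?thesis using const by (intro that[of "\<lambda>x. Im (f x)"]) metis+
  next
    case False
    moreover have "(\<lambda>x. Re (f x)) \<in> rk_space" using f by (simp add: rk_carrier_def)
    ultimately show ?thesis using const by (intro that[of "\<lambda>x. Re (f x)"]) metis+
  qed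
  let ?\<delta> = "(p \<one>)\<^sup>2 / (sqn p + 1)"
  have pos: "0 < sqn p + 1" using sqn_nonneg[OF p] by simp
  have "?\<delta> * (pairing c (\<lambda>x. 1))\<^sup>2 \<le> kform K c c" if c: "c \<in> combos (carrier G)" for c
  proof -
    have "pairing c p = pairing c (\<lambda>x. p \<one> * 1)"
      using c by (intro pairing_cong) (auto simp: combos_def intro: pc)
    then have "pairing c p = p \<one> * pairing c (\<lambda>x. 1)"
      using pairing_cmult[of c "p \<one>" "\<lambda>x. 1"] by simp
    then have "(p \<one>)\<^sup>2 * (pairing c (\<lambda>x. 1))\<^sup>2 \<le> sqn p * kform K c c"
      using pairing_sq_le[OF p c] by (simp add: power_mult_distrib)
    also have "\<dots> \<le> (sqn p + 1) * kform K c c" using psd[OF c] by (simp add: algebra_simps)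
    finally show ?thesis using pos by (simp add: field_simps)
  qed
  moreover have "0 < ?\<delta>" using pos p1 by simp
  ultimately show ?thesis by blast
qed

end

text \<open>Property (T) enters only through this consequence, which moreover is trivial for finite
  groups, with \<open>Q\<close> the whole group.\<close>

definition kernel_rigid :: "'a monoid \<Rightarrow> bool" where
  "kernel_rigid G \<longleftrightarrow> (\<exists>Q \<epsilon>. finite Q \<and> Q \<subseteq> carrier G \<and> 0 < \<epsilon> \<and>
     (\<forall>K g. invariant_kernel G K \<and> K \<one>\<^bsub>G\<^esub> \<one>\<^bsub>G\<^esub> = 1 \<and> (\<forall>q \<in> Q. 1 - K q \<one>\<^bsub>G\<^esub> < \<epsilon>) \<and> g \<in> carrier G
        \<longrightarrow> 1 / 2 \<le> K g \<one>\<^bsub>G\<^esub>))"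

lemma finite_kernel_rigid: "finite (carrier G) \<Longrightarrow> kernel_rigid G"
  unfolding kernel_rigid_def by (intro exI[of _ "carrier G"] exI[of _ "1 / 2"]) force

text \<open>Subtract from \<open>K\<close> the largest constant kernel that leaves it positive semidefinite. By
  maximality the remaining representation has no invariant vector, so by property (T) its cyclic
  vector is not almost invariant unless it is short.\<close>

lemma property_T_kernel_rigid:
  fixes G :: "nat monoid"
  assumes "group G" "property_T G"
  shows "kernel_rigid G"
proof -
  obtain Q \<epsilon> where Q: "finite Q" "Q \<subseteq> carrier G" and \<epsilon>: "0 < \<epsilon>" and T:
    "\<And>(H :: (nat \<Rightarrow> complex) inner_product_module) \<pi> \<xi>.
       \<lbrakk>unitary_representation G H \<pi>; \<xi> \<in> carrier H; \<xi> \<noteq> \<zero>\<^bsub>H\<^esub>;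
        \<And>q. q \<in> Q \<Longrightarrow> hnorm H (\<pi> q \<xi> \<ominus>\<^bsub>H\<^esub> \<xi>) < \<epsilon> * hnorm H \<xi>\<rbrakk> \<Longrightarrow>
       \<exists>\<eta> \<in> carrier H. \<eta> \<noteq> \<zero>\<^bsub>H\<^esub> \<and> (\<forall>g \<in> carrier G. \<pi> g \<eta> = \<eta>)"
    using assms(2) unfolding property_T_def by (metis (no_types, lifting))
  show ?thesis
    unfolding kernel_rigid_def
  \<comment> \<open>A value \<open>K g \<one> < 1 / 2\<close> will force \<open>r < 3 / 4\<close>,
    so the cyclic vector has squared norm \<open>1 - r > 1 / 4\<close>. Its squared displacement by
    \<open>q\<close> is \<open>2 * (1 - K q \<one>)\<close>, which the bound
    \<open>\<epsilon>\<^sup>2 / 8\<close> makes smaller than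
    \<open>\<epsilon>\<^sup>2 / 4\<close>.\<close>
  proof (intro exI[of _ Q] exI[of _ "\<epsilon>\<^sup>2 / 8"] conjI allI impI)
    fix K g
    assume "invariant_kernel G K \<and> K \<one>\<^bsub>G\<^esub> \<one>\<^bsub>G\<^esub> = 1 \<and> (\<forall>q \<in> Q. 1 - K q \<one>\<^bsub>G\<^esub> < \<epsilon>\<^sup>2 / 8)
      \<and> g \<in> carrier G"
    then have K: "invariant_kernel G K" and K1: "K \<one>\<^bsub>G\<^esub> \<one>\<^bsub>G\<^esub> = 1"
      and small: "\<And>q. q \<in> Q \<Longrightarrow> 1 - K q \<one>\<^bsub>G\<^esub> < \<epsilon>\<^sup>2 / 8" and g: "g \<in> carrier G" by blast+
    interpret K: invariant_kernel G K by (rule K)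
    let ?C = "combos (carrier G)"
    \<comment> \<open>The squared sum of the coefficients is the quadratic form of the constant
      kernel 1, so \<open>S\<close> collects the \<open>r\<close> for which \<open>K - r\<close> is
      positive semidefinite.\<close>
    define S where "S = {r. \<forall>c \<in> ?C. r * (pairing c (\<lambda>x. 1))\<^sup>2 \<le> kform K c c}"
    have S1: "r \<le> 1" if "r \<in> S" for r
    proof -
      have "r * (pairing [(1, \<one>\<^bsub>G\<^esub>)] (\<lambda>x. 1))\<^sup>2 \<le> kform K [(1, \<one>\<^bsub>G\<^esub>)] [(1, \<one>\<^bsub>G\<^esub>)]"
        using that unfolding S_def by (auto simp del: pairing_Cons)
      then show ?thesis by (simp add: kform_def K1)
    qed
    have S0: "0 \<in> S" by (simp add: S_def K.psd)
    define r where "r = Sup S"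
    \<comment> \<open>The supremum is attained because each \<open>c\<close> imposes a closed
      condition on \<open>r\<close>.\<close>
    have rS: "r \<in> S"
      unfolding S_def
    proof (intro CollectI ballI)
      fix c assume c: "c \<in> ?C"
      show "r * (pairing c (\<lambda>x. 1))\<^sup>2 \<le> kform K c c"
      proof (cases "pairing c (\<lambda>x. 1) = 0")
        case True then show ?thesis using K.psd[OF c] by simp
      next
        case False
        have "r \<le> kform K c c / (pairing c (\<lambda>x. 1))\<^sup>2"
          unfolding r_def
        proof (rule cSup_least)
          show "S \<noteq> {}" using S0 by blast
          show "u \<le> kform K c c / (pairing c (\<lambda>x. 1))\<^sup>2" if "u \<in> S" for u
            using that c False by (simp add: S_def field_simps)
        qed
        then show ?thesis using False by (simp add: field_simps)
      qed
    qed
    define L where "L = (\<lambda>x y. K x y - r)"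
    have L: "kform L c d = kform K c d - r * pairing c (\<lambda>x. 1) * pairing d (\<lambda>x. 1)" for c d
    proof -
      have "kform L c d = kform K c d - pairing c (\<lambda>x. pairing d (\<lambda>y. r))"
        by (simp add: kform_def L_def pairing_diff)
      also have "pairing d (\<lambda>y. r) = r * pairing d (\<lambda>x. 1)" by (rule pairing_const)
      also have "pairing c (\<lambda>x. r * pairing d (\<lambda>x. 1))
          = r * pairing d (\<lambda>x. 1) * pairing c (\<lambda>x. 1)" by (rule pairing_const)
      finally show ?thesis by (simp add: mult_ac)
    qed
    interpret L: invariant_kernel G L
    proof
      show "L x y = L y x" if "x \<in> carrier G" "y \<in> carrier G" for x y
        using K.sym[OF that] by (simp add: L_def)
      show "0 \<le> kform L c c" if "c \<in> ?C" for c
        using rS that by (auto simp: S_def L power2_eq_square)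
      show "L (h \<otimes>\<^bsub>G\<^esub> x) (h \<otimes>\<^bsub>G\<^esub> y) = L x y"
        if "h \<in> carrier G" "x \<in> carrier G" "y \<in> carrier G" for h x y
        using K.invariant[OF that] by (simp add: L_def)
    qed
    have one: "\<one>\<^bsub>G\<^esub> \<in> carrier G" by simp
    have diag: "K x x = 1" if "x \<in> carrier G" for x
      using K.invariant[OF that one one] K1 that by simp
    show "1 / 2 \<le> K g \<one>\<^bsub>G\<^esub>"
    proof (rule ccontr)
      assume "\<not> ?thesis"
      \<comment> \<open>Testing \<open>L\<close> on the sum of the point masses at \<open>g\<close>
        and at the identity gives \<open>4 * r \<le> 2 + 2 * K g \<one> < 3\<close>.\<close>
      moreover have "0 \<le> kform L [(1, g), (1, \<one>\<^bsub>G\<^esub>)] [(1, g), (1, \<one>\<^bsub>G\<^esub>)]"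
        using g by (intro L.psd) auto
      then have "0 \<le> 2 + 2 * K g \<one>\<^bsub>G\<^esub> - 4 * r"
        using g by (simp add: kform_def L_def diag K1 K.sym[OF one g] algebra_simps)
      ultimately have "r < 3 / 4" by simp
      let ?\<xi> = "\<lambda>d x. complex_of_real (L.kvec d x)"
      let ?e = "[(1, \<one>\<^bsub>G\<^esub>)]"
      have e: "?e \<in> ?C" by simp
      have norm_e: "hnorm L.rk_hilbert (?\<xi> ?e) = sqrt (1 - r)"
        using L.real_kvec_carrier(2)[OF e] by (simp add: kform_def L_def K1)
      have "L.kvec ?e \<one>\<^bsub>G\<^esub> = L \<one>\<^bsub>G\<^esub> \<one>\<^bsub>G\<^esub>" by (simp add: L.kvec_def)
      then have "L.kvec ?e \<one>\<^bsub>G\<^esub> \<noteq> 0" using \<open>r < 3 / 4\<close> K1 by (simp add: L_def)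
      then have "?\<xi> ?e \<noteq> (\<lambda>x. 0)" by (auto simp: fun_eq_iff)
      moreover have "hnorm L.rk_hilbert (L.rk_rep q (?\<xi> ?e) \<ominus>\<^bsub>L.rk_hilbert\<^esub> ?\<xi> ?e)
          < \<epsilon> * hnorm L.rk_hilbert (?\<xi> ?e)" if "q \<in> Q" for q
      proof -
        have q: "q \<in> carrier G" using that Q by auto
        let ?d = "[(1, q), (-1, \<one>\<^bsub>G\<^esub>)]"
        have d: "?d \<in> ?C" using q by simp
        have "L.rk_rep q (?\<xi> ?e) \<ominus>\<^bsub>L.rk_hilbert\<^esub> ?\<xi> ?e = ?\<xi> ?d"
        proof -
          have "[(1, q)] \<in> ?C" using q by simp
          note tr = this[THEN L.real_kvec_carrier(1), THEN L.trunc_in]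
            L.real_kvec_carrier(1)[OF e, THEN L.trunc_in]
          show ?thesis
            unfolding L.rk_rep_kvec[OF q] L.rk_minus tr by (auto simp: L.kvec_def)
        qed
        then have "hnorm L.rk_hilbert (L.rk_rep q (?\<xi> ?e) \<ominus>\<^bsub>L.rk_hilbert\<^esub> ?\<xi> ?e)
            = sqrt (kform L ?d ?d)"
          using L.real_kvec_carrier(2)[OF d] by simp
        also have "kform L ?d ?d = 2 * (1 - K q \<one>\<^bsub>G\<^esub>)"
          using q by (simp add: kform_def L_def diag K1 K.sym[OF one q] algebra_simps)
        also have "sqrt (2 * (1 - K q \<one>\<^bsub>G\<^esub>)) < sqrt (\<epsilon>\<^sup>2 * (1 - r))"
        proof -
          have "2 * (1 - K q \<one>\<^bsub>G\<^esub>) < \<epsilon>\<^sup>2 * (1 / 4)" using small[OF that] by simp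
          also have "\<dots> \<le> \<epsilon>\<^sup>2 * (1 - r)" using \<open>r < 3 / 4\<close> by (intro mult_left_mono) auto
          finally show ?thesis by simp
        qed
        finally show ?thesis using \<epsilon> by (simp add: norm_e real_sqrt_mult)
      qed
      ultimately have "\<exists>\<eta> \<in> carrier L.rk_hilbert. \<eta> \<noteq> \<zero>\<^bsub>L.rk_hilbert\<^esub> \<and> (\<forall>g \<in> carrier G. L.rk_rep g \<eta> = \<eta>)"
        using L.real_kvec_carrier(1)[OF e]
        by (intro T[OF L.rk_rep_unitary, of "?\<xi> ?e"]) simp_all
      then obtain \<eta> where "\<eta> \<in> L.rk_carrier" "\<eta> \<noteq> (\<lambda>x. 0)" "\<And>g. g \<in> carrier G \<Longrightarrow> L.rk_rep g \<eta> = \<eta>"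
        unfolding L.rk_hilbert_simps by blast
      then obtain \<delta> where \<delta>: "0 < \<delta>" "\<And>c. c \<in> ?C \<Longrightarrow> \<delta> * (pairing c (\<lambda>x. 1))\<^sup>2 \<le> kform L c c"
        using L.rk_rep_invariant_vector[of \<eta>] by blast
      then have "r + \<delta> \<in> S"
        by (auto simp: S_def L power2_eq_square algebra_simps)
      then have "r + \<delta> \<le> r"
        unfolding r_def by (intro cSup_upper bdd_aboveI[of _ 1] S1)
      then show False using \<delta>(1) by simp
    qed
  qed (use Q \<epsilon> in auto)
qed

section \<open>Words and limits of marked groups\<close>

text \<open>Words need not be reduced, so they are closed under concatenation and evaluation is
  multiplicative without any cancellation.\<close>

definition words :: "nat \<Rightarrow> (nat \<times> bool) list set" where
  "words k = {w. \<forall>l \<in> set w. fst l < k}"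

definition inv_word :: "(nat \<times> bool) list \<Rightarrow> (nat \<times> bool) list" where
  "inv_word w = rev (map (\<lambda>(i, e). (i, \<not> e)) w)"

definition letter_value :: "'a monoid \<Rightarrow> 'a list \<Rightarrow> nat \<times> bool \<Rightarrow> 'a" where
  "letter_value G s l = (if snd l then s ! fst l else inv\<^bsub>G\<^esub> (s ! fst l))"

lemma words_Nil [simp]: "[] \<in> words k"
  and words_Cons [simp]: "l # w \<in> words k \<longleftrightarrow> fst l < k \<and> w \<in> words k"
  and words_append [simp]: "u @ w \<in> words k \<longleftrightarrow> u \<in> words k \<and> w \<in> words k"
  by (auto simp: words_def)

lemma inv_word_in [simp]: "inv_word w \<in> words k \<longleftrightarrow> w \<in> words k"
  by (auto simp: words_def inv_word_def split: prod.splits)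

lemma free_group_words_subset: "free_group_words k \<subseteq> words k"
  by (auto simp: free_group_words_def words_def)

lemma finite_words_length: "finite {w \<in> words k. length w = n}"
proof -
  have "{w \<in> words k. length w = n} = {w. set w \<subseteq> {..<k} \<times> UNIV \<and> length w = n}"
    by (auto simp: words_def)
  then show ?thesis by (simp add: finite_lists_length_eq)
qed

lemma word_value_Nil [simp]: "word_value G s [] = \<one>\<^bsub>G\<^esub>"
  and word_value_Cons [simp]: "word_value G s (l # w) = letter_value G s l \<otimes>\<^bsub>G\<^esub> word_value G s w"
  by (auto simp: word_value_def letter_value_def split: prod.splits)

locale marked = group G for G :: "'a monoid" (structure) +
  fixes s :: "'a list" and k :: nat
  assumes length_s: "length s = k" and s_subset: "set s \<subseteq> carrier G"
begin

lemma letter_closed [simp]: "fst l < k \<Longrightarrow> letter_value G s l \<in> carrier G"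
  using s_subset length_s by (auto simp: letter_value_def subset_iff)

lemma word_closed [simp]: "w \<in> words k \<Longrightarrow> word_value G s w \<in> carrier G"
  by (induction w) auto

lemma word_value_append:
  "u \<in> words k \<Longrightarrow> w \<in> words k \<Longrightarrow> word_value G s (u @ w) = word_value G s u \<otimes> word_value G s w"
  by (induction u) (auto simp: m_assoc)

lemma word_value_inv: "w \<in> words k \<Longrightarrow> word_value G s (inv_word w) = inv (word_value G s w)"
proof (induction w)
  case (Cons l w)
  obtain i e where l: "l = (i, e)" by (cases l)
  have i: "i < k" using Cons.prems l by simp
  have eq: "inv_word ((i, e) # w) = inv_word w @ [(i, \<not> e)]" by (simp add: inv_word_def)
  have "s ! i \<in> carrier G" using letter_closed[of "(i, True)"] i by (simp add: letter_value_def)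
  then have "letter_value G s (i, \<not> e) = inv (letter_value G s (i, e))"
    by (simp add: letter_value_def)
  then show ?case
    using Cons i l by (simp add: eq word_value_append inv_mult_group)
qed (simp add: inv_word_def)

lemma word_value_in_generate: "w \<in> words k \<Longrightarrow> word_value G s w \<in> generate G (set s)"
proof (induction w)
  case Nil then show ?case by (simp add: generate.one)
next
  case (Cons l w)
  then have "letter_value G s l \<in> generate G (set s)"
    using length_s by (auto simp: letter_value_def intro: generate.incl generate.inv)
  then show ?case using Cons by (simp add: generate.eng)
qed

lemma generate_eq_words: "generate G (set s) = word_value G s ` words k"
proof
  show "word_value G s ` words k \<subseteq> generate G (set s)" using word_value_in_generate by auto
  have letter: "\<exists>w \<in> words k. x = word_value G s w" if x: "x = letter_value G s (i, e)" and "i < k" for x i e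
    using that by (intro bexI[of _ "[(i, e)]"]) auto
  show "generate G (set s) \<subseteq> word_value G s ` words k"
  proof
    fix x assume "x \<in> generate G (set s)"
    then show "x \<in> word_value G s ` words k"
    proof induction
      case one show ?case by (rule image_eqI[of _ _ "[]"]) auto
    next
      case (incl x)
      then obtain i where "i < k" "x = s ! i" using length_s by (auto simp: in_set_conv_nth)
      then show ?case using letter[of x i True] by (auto simp: letter_value_def)
    next
      case (inv x)
      then obtain i where "i < k" "x = s ! i" using length_s by (auto simp: in_set_conv_nth)
      then show ?case using letter[of "inv x" i False] by (auto simp: letter_value_def)
    next
      case (eng x y)
      then obtain u v where "u \<in> words k" "v \<in> words k" "x = word_value G s u" "y = word_value G s v" by auto
      then show ?case by (intro image_eqI[of _ _ "u @ v"]) (auto simp: word_value_append)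
    qed
  qed
qed

lemma word_value_hom:
  assumes "group H" and h: "h \<in> hom G H" and w: "w \<in> words k"
  shows "word_value H (map h s) w = h (word_value G s w)"
proof -
  interpret H: group_hom G H h
    using assms by (simp add: group_hom_def group_hom_axioms_def group_axioms)
  have "letter_value H (map h s) l = h (letter_value G s l)" if "fst l < k" for l
    using that length_s s_subset by (auto simp: letter_value_def subset_iff)
  then show ?thesis using w by (induction w) auto
qed

end

lemma marked_group_iff:
  "marked_group k G s \<longleftrightarrow> marked G s k \<and> carrier G = word_value G s ` words k"
  unfolding marked_group_def marked_def marked_axioms_def
  using marked.generate_eq_words[of G s k] by (auto simp: marked_def marked_axioms_def)

lemma marked_groupI:
  assumes "marked G s k" and "\<And>x. x \<in> carrier G \<Longrightarrow> \<exists>w \<in> words k. word_value G s w = x"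
  shows "marked_group k G s"
proof -
  interpret marked G s k by fact
  have "carrier G = word_value G s ` words k" using assms(2) by fastforce
  then show ?thesis using assms(1) by (simp add: marked_group_iff)
qed

lemma marked_group_iso:
  assumes G: "marked_group k G s" and H: "group H" and h: "h \<in> iso G H"
  shows "marked_group k H (map h s)"
proof -
  interpret marked G s k using G by (simp add: marked_group_iff)
  have hh: "h \<in> hom G H" and bij: "bij_betw h (carrier G) (carrier H)" using h by (auto simp: iso_def)
  have carrier: "carrier G = word_value G s ` words k" using G by (simp add: marked_group_iff)
  have "marked H (map h s) k"
    unfolding marked_def marked_axioms_def
    using H length_s s_subset hh by (auto simp: hom_def)
  moreover have "\<exists>w \<in> words k. word_value H (map h s) w = y" if "y \<in> carrier H" for y
    using that bij carrier by (force simp: bij_betw_def word_value_hom[OF H hh])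
  ultimately show ?thesis by (rule marked_groupI)
qed

lemma word_value_marked_iso:
  assumes G: "marked_group k G s" and H: "marked_group k H t" and "marked_iso G s H t"
    and u: "u \<in> words k" and w: "w \<in> words k"
  shows "word_value H t u = word_value H t w \<longleftrightarrow> word_value G s u = word_value G s w"
proof -
  interpret marked G s k using G by (simp add: marked_group_iff)
  obtain h where h: "h \<in> iso G H" and t: "t = map h s" using assms(3) by (auto simp: marked_iso_def)
  have hh: "h \<in> hom G H" and inj: "inj_on h (carrier G)" using h by (auto simp: iso_def bij_betw_def)
  have "group H" using H by (simp add: marked_group_def)
  then show ?thesis
    unfolding t using u w by (simp add: word_value_hom[OF _ hh] inj_on_eq_iff[OF inj])
qed

lemma marked_class_of_iso:
  assumes G: "marked_group k G s" and H: "marked_group k H t" and iso: "marked_iso G s H t"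
  shows "marked_class_of k G s = marked_class_of k H t"
proof -
  obtain h where h: "h \<in> iso G H" and t: "t = map h s" using iso by (auto simp: marked_iso_def)
  have grp: "group G" "group H" and sub: "set s \<subseteq> carrier G"
    using G H by (auto simp: marked_group_def)
  let ?g = "inv_into (carrier G) h"
  have g: "?g \<in> iso H G" by (rule group.iso_set_sym[OF grp(1) h])
  have gt: "map ?g t = s"
    unfolding t using h sub by (auto simp: iso_def bij_betw_def subset_iff intro!: map_idI)
  have "marked_iso G s L u \<longleftrightarrow> marked_iso H t L u" for L :: "nat monoid" and u
  proof
    assume "marked_iso G s L u"
    then obtain f where f: "f \<in> iso G L" "map f s = u" by (auto simp: marked_iso_def)
    have "f \<circ> ?g \<in> iso H L" by (rule iso_set_trans[OF g f(1)])
    moreover have "map (f \<circ> ?g) t = u" using f(2) gt by (metis map_map)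
    ultimately show "marked_iso H t L u" by (auto simp: marked_iso_def)
  next
    assume "marked_iso H t L u"
    then obtain f where f: "f \<in> iso H L" "map f t = u" by (auto simp: marked_iso_def)
    have "f \<circ> h \<in> iso G L" by (rule iso_set_trans[OF h f(1)])
    moreover have "map (f \<circ> h) s = u" using f(2) t by simp
    ultimately show "marked_iso G s L u" by (auto simp: marked_iso_def)
  qed
  then show ?thesis by (simp add: marked_class_of_def)
qed

lemma marked_iso_refl: "marked_iso G s G s"
  using id_iso[of G] by (auto simp: marked_iso_def intro!: bexI[of _ id])

lemma marked_class_of_self: "marked_group k G s \<Longrightarrow> (G, s) \<in> marked_class_of k G s"
  by (simp add: marked_class_of_def marked_iso_refl)

text \<open>The carrier is an image of the countable set of words; the group structure is
  transported along an injection into \<open>nat\<close>.\<close>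

lemma marked_group_nat_copy:
  assumes G: "marked_group k G s"
  obtains H :: "nat monoid" and t where "marked_group k H t" "marked_iso G s H t"
proof -
  interpret marked G s k using G by (simp add: marked_group_iff)
  have "countable (carrier G)" using G by (simp add: marked_group_iff)
  then obtain f :: "'a \<Rightarrow> nat" where f: "inj_on f (carrier G)" by (auto simp: countable_def)
  let ?g = "inv_into (carrier G) f"
  define H where "H = \<lparr>carrier = f ` carrier G, mult = (\<lambda>x y. f (?g x \<otimes>\<^bsub>G\<^esub> ?g y)), one = f \<one>\<^bsub>G\<^esub>\<rparr>"
  have h: "f \<in> iso G H"
    using f by (auto simp: iso_def hom_def H_def bij_betw_def)
  have "group (H\<lparr>carrier := f ` carrier G, one := f \<one>\<^bsub>G\<^esub>\<rparr>)"
    by (rule hom_imp_img_group) (use h in \<open>simp add: iso_def\<close>)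
  then have "group H" by (simp add: H_def)
  from marked_group_iso[OF G this h] show ?thesis
    using that h by (auto simp: marked_iso_def)
qed

lemma marked_class_of_in: "marked_group k G s \<Longrightarrow> marked_class_of k G s \<in> marked_groups k"
  using marked_group_nat_copy[of k G s] marked_class_of_iso[of k G s]
  by (smt (verit, best) marked_groups_def mem_Collect_eq)

text \<open>The quantifier over representatives can be replaced by any one of them, as a class is
  nonempty and its members satisfy the same word equations. The representative may live on any
  type.\<close>

lemma relator_set_iff:
  assumes G: "marked_group k G s" and w: "w \<in> words k"
  shows "marked_class_of k G s \<in> relator_set k w \<longleftrightarrow> word_value G s w = \<one>\<^bsub>G\<^esub>"
proof -
  have iff: "word_value H t w = \<one>\<^bsub>H\<^esub> \<longleftrightarrow> word_value G s w = \<one>\<^bsub>G\<^esub>"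
    if "(H, t) \<in> marked_class_of k G s" for H t
    using word_value_marked_iso[OF G, of H t w "[]"] that w by (simp add: marked_class_of_def)
  obtain H :: "nat monoid" and t where "marked_group k H t" "marked_iso G s H t"
    using marked_group_nat_copy[OF G] by blast
  then have "(H, t) \<in> marked_class_of k G s" by (simp add: marked_class_of_def)
  then show ?thesis
    using iff marked_class_of_in[OF G] unfolding relator_set_def by blast
qed

text \<open>Eventual membership holds for the subbasic sets by assumption and passes through finite
  intersections and unions, hence to every open set around \<open>L\<close>.\<close>

lemma cayley_closureI:
  assumes L: "L \<in> marked_groups k" and c: "\<And>n. c n \<in> marked_groups k" "\<And>n. c n \<in> A"
    and conv: "\<And>w. w \<in> free_group_words k \<Longrightarrow>
      \<forall>\<^sub>F n in sequentially. c n \<in> relator_set k w \<longleftrightarrow> L \<in> relator_set k w"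
  shows "L \<in> (cayley_topology k) closure_of A"
proof -
  let ?B = "\<Union>w \<in> free_group_words k. {relator_set k w, marked_groups k - relator_set k w}"
  have ev: "\<forall>\<^sub>F n in sequentially. c n \<in> T" if "generate_topology_on ?B T" "L \<in> T" for T
    using that
  proof induction
    case (Int a b) then show ?case by (auto intro: eventually_conj)
  next
    case (UN K)
    then obtain T where "T \<in> K" "\<forall>\<^sub>F n in sequentially. c n \<in> T" by blast
    then show ?case by (auto elim: eventually_mono)
  next
    case (Basis T)
    then obtain w where w: "w \<in> free_group_words k"
      and T: "T = relator_set k w \<or> T = marked_groups k - relator_set k w" by blast
    from conv[OF w] show ?case
      by (rule eventually_mono) (use T c(1) Basis.prems in auto)
  qed simp
  \<comment> \<open>The relator set of one word and its complement already cover
    \<open>marked_groups k\<close>, which puts \<open>L\<close> into the topological space.\<close>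
  have "[] \<in> free_group_words k" by (simp add: free_group_words_def)
  then have "L \<in> topspace (cayley_topology k)" using L by (auto simp: cayley_topology_def)
  moreover have "\<exists>y. y \<in> A \<and> y \<in> T" if "openin (cayley_topology k) T" "L \<in> T" for T
    using ev[of T] that c(2) eventually_happens'[OF sequentially_bot]
    unfolding cayley_topology_def openin_topology_generated_by_iff by blast
  ultimately show ?thesis by (auto simp: in_closure_of)
qed

section \<open>The limit of a sequence in which every relation eventually holds or eventually
  fails\<close>

locale word_limit =
  fixes G :: "nat \<Rightarrow> 'a monoid" and s :: "nat \<Rightarrow> 'a list" and k :: nat
  assumes marked: "\<And>j. marked_group k (G j) (s j)"
    and settles: "\<And>w. w \<in> words k \<Longrightarrow>
      (\<forall>\<^sub>F j in sequentially. word_value (G j) (s j) w = \<one>\<^bsub>G j\<^esub>) \<or>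
      (\<forall>\<^sub>F j in sequentially. word_value (G j) (s j) w \<noteq> \<one>\<^bsub>G j\<^esub>)"
begin

definition eqv :: "(nat \<times> bool) list \<Rightarrow> (nat \<times> bool) list \<Rightarrow> bool" where
  "eqv u w \<longleftrightarrow> (\<forall>\<^sub>F j in sequentially. word_value (G j) (s j) u = word_value (G j) (s j) w)"

lemma marked_j: "marked (G j) (s j) k"
  using marked by (simp add: marked_group_iff)

lemmas word_append_j = marked.word_value_append[OF marked_j]
  and word_inv_j = marked.word_value_inv[OF marked_j]
  and word_closed_j = marked.word_closed[OF marked_j]
  and group_j = marked.axioms(1)[OF marked_j]

lemma eqv_refl: "eqv u u" by (simp add: eqv_def)

lemma eqv_sym: "eqv u w \<Longrightarrow> eqv w u" unfolding eqv_def by (simp add: eq_commute)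

lemma eqv_trans: "eqv u v \<Longrightarrow> eqv v w \<Longrightarrow> eqv u w"
  unfolding eqv_def by (auto elim: eventually_elim2)

lemma eqv_append:
  assumes "u \<in> words k" "v \<in> words k" "u' \<in> words k" "v' \<in> words k" "eqv u u'" "eqv v v'"
  shows "eqv (u @ v) (u' @ v')"
  using assms(5,6) unfolding eqv_def
  by eventually_elim (simp add: word_append_j assms)

text \<open>An equation between \<open>u\<close> and \<open>w\<close> is the relation
  \<open>u @ inv_word w\<close>, so the dichotomy for relators carries over to equations.\<close>

lemma not_eqv:
  assumes u: "u \<in> words k" and w: "w \<in> words k" and "\<not> eqv u w"
  shows "\<forall>\<^sub>F j in sequentially. word_value (G j) (s j) u \<noteq> word_value (G j) (s j) w"
proof -
  have iff: "word_value (G j) (s j) (u @ inv_word w) = \<one>\<^bsub>G j\<^esub> \<longleftrightarrow>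
      word_value (G j) (s j) u = word_value (G j) (s j) w" for j
    using u w group_j[of j] word_closed_j[OF u, of j] word_closed_j[OF w, of j]
    by (simp add: word_append_j word_inv_j)
       (metis group.inv_equality group.inv_inv group.r_inv group.inv_closed)
  show ?thesis
    using settles[of "u @ inv_word w"] u w assms(3) by (simp add: iff eqv_def)
qed

text \<open>Each class of eventually equal words is named by the least number encoding one of its
  members. This makes the quotient a group on \<open>nat\<close>, as \<open>marked_class\<close> and
  the Hilbert spaces in \<open>property_T\<close> require.\<close>

definition code :: "(nat \<times> bool) list \<Rightarrow> nat" where
  "code w = (LEAST n. \<exists>u \<in> words k. to_nat u = n \<and> eqv u w)"

definition decode :: "nat \<Rightarrow> (nat \<times> bool) list" where
  "decode = from_nat"

lemma decode_code:
  assumes "w \<in> words k"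
  shows "decode (code w) \<in> words k" "eqv (decode (code w)) w"
proof -
  have "\<exists>n. \<exists>u \<in> words k. to_nat u = n \<and> eqv u w" using assms eqv_refl by blast
  from LeastI_ex[OF this] obtain u where "u \<in> words k" "to_nat u = code w" "eqv u w"
    by (auto simp: code_def[symmetric])
  then show "decode (code w) \<in> words k" "eqv (decode (code w)) w"
    unfolding decode_def by (metis from_nat_to_nat)+
qed

lemma code_eq_iff:
  assumes "u \<in> words k" "w \<in> words k"
  shows "code u = code w \<longleftrightarrow> eqv u w"
proof
  assume "code u = code w"
  then show "eqv u w" using decode_code[OF assms(1)] decode_code[OF assms(2)] eqv_sym eqv_trans by metis
next
  assume "eqv u w"
  then have "eqv v u \<longleftrightarrow> eqv v w" for v using eqv_sym eqv_trans by blast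
  then show "code u = code w" by (simp add: code_def)
qed

text \<open>The quotient of the free group of rank \<open>k\<close> by the words that are eventually
  trivial, on numerical codes of its elements.\<close>

definition limit_group :: "nat monoid" where
  "limit_group = \<lparr>carrier = code ` words k, mult = (\<lambda>m n. code (decode m @ decode n)), one = code []\<rparr>"

definition limit_gens :: "nat list" where
  "limit_gens = map (\<lambda>i. code [(i, True)]) [0..<k]"

lemma limit_group_simps:
  "carrier limit_group = code ` words k" "\<one>\<^bsub>limit_group\<^esub> = code []"
  by (simp_all add: limit_group_def)

lemma limit_mult:
  assumes "u \<in> words k" "w \<in> words k"
  shows "code u \<otimes>\<^bsub>limit_group\<^esub> code w = code (u @ w)"
  using assms decode_code[OF assms(1)] decode_code[OF assms(2)]
  by (simp add: limit_group_def code_eq_iff eqv_append)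

lemma eqv_inv_word: "w \<in> words k \<Longrightarrow> eqv (inv_word w @ w) []"
  unfolding eqv_def using group_j by (simp add: word_append_j word_inv_j word_closed_j group.l_inv)

lemma group_limit: "group limit_group"
proof (rule groupI)
  show "\<exists>y\<in>carrier limit_group. y \<otimes>\<^bsub>limit_group\<^esub> x = \<one>\<^bsub>limit_group\<^esub>"
    if x: "x \<in> carrier limit_group" for x
  proof -
    obtain w where w: "w \<in> words k" "x = code w" using x by (auto simp: limit_group_simps)
    then show ?thesis
      using eqv_inv_word[OF w(1)]
      by (intro bexI[of _ "code (inv_word w)"]) (auto simp: limit_group_simps limit_mult code_eq_iff)
  qed
qed (auto simp: limit_group_simps limit_mult)

lemma limit_inv:
  assumes "w \<in> words k"
  shows "inv\<^bsub>limit_group\<^esub> (code w) = code (inv_word w)"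
  using eqv_inv_word[OF assms] assms
  by (intro group.inv_equality[OF group_limit]) (auto simp: limit_group_simps limit_mult code_eq_iff)

lemma word_value_limit:
  assumes "w \<in> words k"
  shows "word_value limit_group limit_gens w = code w"
  using assms
proof (induction w)
  case Nil show ?case by (simp add: limit_group_simps)
next
  case (Cons l w)
  obtain i e where l: "l = (i, e)" by (cases l)
  have i: "i < k" using Cons.prems l by simp
  have "letter_value limit_group limit_gens (i, e) = code [(i, e)]"
    using i limit_inv[of "[(i, True)]"] by (auto simp: letter_value_def limit_gens_def inv_word_def)
  then show ?case using Cons l i limit_mult[of "[(i, e)]" w] by simp
qed

lemma limit_marked: "marked_group k limit_group limit_gens"
proof (rule marked_groupI)
  show "marked limit_group limit_gens k"
    unfolding marked_def marked_axioms_def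
    by (auto simp: group_limit limit_gens_def limit_group_simps)
qed (auto simp: limit_group_simps word_value_limit)

lemma limit_word_eq_iff:
  assumes "u \<in> words k" "w \<in> words k"
  shows "word_value limit_group limit_gens u = word_value limit_group limit_gens w \<longleftrightarrow>
      (\<forall>\<^sub>F j in sequentially. word_value (G j) (s j) u = word_value (G j) (s j) w)"
  using assms by (simp add: word_value_limit code_eq_iff eqv_def)

end

text \<open>Sequential compactness of the space of marked groups. There are countably many words, so
  a diagonal subsequence makes the truth value of every relation converge.\<close>

lemma marked_convergent_subsequence:
  fixes G :: "nat \<Rightarrow> 'a monoid"
  assumes marked: "\<And>j. marked_group k (G j) (s j)"
  obtains r :: "nat \<Rightarrow> nat" and H :: "nat monoid" and t where "strict_mono r" "marked_group k H t"
    "\<And>u w. u \<in> words k \<Longrightarrow> w \<in> words k \<Longrightarrow> word_value H t u = word_value H t w \<Longrightarrow>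
      \<forall>\<^sub>F j in sequentially. word_value (G (r j)) (s (r j)) u = word_value (G (r j)) (s (r j)) w"
    "\<And>u w. u \<in> words k \<Longrightarrow> w \<in> words k \<Longrightarrow> word_value H t u \<noteq> word_value H t w \<Longrightarrow>
      \<forall>\<^sub>F j in sequentially. word_value (G (r j)) (s (r j)) u \<noteq> word_value (G (r j)) (s (r j)) w"
proof -
  define f :: "nat \<Rightarrow> (nat \<times> bool) list \<Rightarrow> real" where
    "f = (\<lambda>j w. if word_value (G j) (s j) w = \<one>\<^bsub>G j\<^esub> then 1 else 0)"
  obtain r where r: "strict_mono (r :: nat \<Rightarrow> nat)" and lim: "\<And>w. \<exists>l. (\<lambda>j. f (r j) w) \<longlonglongrightarrow> l"
    by (rule function_convergent_subsequence[of UNIV f 1]) (auto simp: f_def)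
  interpret word_limit "\<lambda>j. G (r j)" "\<lambda>j. s (r j)" k
  proof
    fix w :: "(nat \<times> bool) list"
    obtain l where l: "(\<lambda>j. f (r j) w) \<longlonglongrightarrow> l" using lim by blast
    show "(\<forall>\<^sub>F j in sequentially. word_value (G (r j)) (s (r j)) w = \<one>\<^bsub>G (r j)\<^esub>) \<or>
      (\<forall>\<^sub>F j in sequentially. word_value (G (r j)) (s (r j)) w \<noteq> \<one>\<^bsub>G (r j)\<^esub>)"
    \<comment> \<open>Truth values are 0 or 1: a positive limit means eventually 1, and a limit
      below 1 means eventually 0.\<close>
    proof (cases "0 < l")
      case True
      have "\<forall>\<^sub>F j in sequentially. 0 < f (r j) w" by (rule order_tendstoD(1)[OF l True])
      then have "\<forall>\<^sub>F j in sequentially. word_value (G (r j)) (s (r j)) w = \<one>\<^bsub>G (r j)\<^esub>"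
        by (rule eventually_mono) (simp add: f_def split: if_splits)
      then show ?thesis ..
    next
      case False
      then have "l < 1" by simp
      from order_tendstoD(2)[OF l this]
      have "\<forall>\<^sub>F j in sequentially. word_value (G (r j)) (s (r j)) w \<noteq> \<one>\<^bsub>G (r j)\<^esub>"
        by (rule eventually_mono) (simp add: f_def split: if_splits)
      then show ?thesis ..
    qed
  qed (rule marked)
  show ?thesis
    by (rule that[OF r limit_marked])
       (use limit_word_eq_iff not_eqv in \<open>auto simp: word_value_limit code_eq_iff eqv_def\<close>)
qed

section \<open>Correlations of Laplace eigenfunctions\<close>

text \<open>Schur's product theorem with one factor a Gram kernel: each summand \<open>z\<close>
  merely reweights the combination by \<open>u z\<close>, which leaves a value of the form of
  \<open>L\<close>.\<close>

lemma gram_times_psd: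
  assumes "\<And>c. c \<in> combos A \<Longrightarrow> 0 \<le> kform L c c" and c: "c \<in> combos A"
  shows "0 \<le> kform (\<lambda>x y. (\<Sum>z\<in>Z. u z x * u z y) * L x y) c c"
proof -
  have "kform (\<lambda>x y. (\<Sum>z\<in>Z. u z x * u z y) * L x y) c c
      = (\<Sum>z\<in>Z. kform (\<lambda>x y. u z x * u z y * L x y) c c)"
    by (simp add: kform_def sum_distrib_right pairing_sum)
  also have "\<dots> = (\<Sum>z\<in>Z. kform L (map (\<lambda>(a, x). (a * u z x, x)) c) (map (\<lambda>(a, x). (a * u z x, x)) c))"
    by (simp add: kform_def pairing_map_weight pairing_cmult mult.assoc)
  also have "\<dots> \<ge> 0"
  proof (rule sum_nonneg)
    fix z
    have "map (\<lambda>(a, x). (a * u z x, x)) c \<in> combos A" using c by (auto simp: combos_def)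
    then show "0 \<le> kform L (map (\<lambda>(a, x). (a * u z x, x)) c) (map (\<lambda>(a, x). (a * u z x, x)) c)"
      by (rule assms(1))
  qed
  finally show ?thesis .
qed

lemma gram_power_psd:
  assumes "c \<in> combos A"
  shows "0 \<le> kform (\<lambda>x y. (\<Sum>z\<in>Z. u z x * u z y) ^ n) c c"
  using assms
proof (induction n arbitrary: c)
  case 0
  have "kform (\<lambda>x y. 1) c c = (pairing c (\<lambda>x. 1))\<^sup>2"
    unfolding kform_def by (subst pairing_const) (simp add: power2_eq_square)
  then show ?case by simp
next
  case (Suc n)
  then show ?case using gram_times_psd[of A "\<lambda>x y. (\<Sum>z\<in>Z. u z x * u z y) ^ n"] by simp
qed

text \<open>As a set it counts coinciding generators once, as the graph does. Its cardinality is
  thus the degree, including the loop of a trivial generator.\<close>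

definition sym_gens :: "'a monoid \<Rightarrow> 'a list \<Rightarrow> 'a set" where
  "sym_gens G s = set s \<union> m_inv G ` set s"

text \<open>The inner product of the left translates of \<open>f\<close> by \<open>x\<close> and
  \<open>y\<close>, a coefficient of the regular representation. With first argument the identity it
  is the \<open>\<phi>\<close> of the overview.\<close>

definition corr :: "'a monoid \<Rightarrow> ('a \<Rightarrow> real) \<Rightarrow> 'a \<Rightarrow> 'a \<Rightarrow> real" where
  "corr G f x y = (\<Sum>z \<in> carrier G. f (inv\<^bsub>G\<^esub> x \<otimes>\<^bsub>G\<^esub> z) * f (inv\<^bsub>G\<^esub> y \<otimes>\<^bsub>G\<^esub> z))"

lemma corr_sym: "corr G f x y = corr G f y x"
  by (simp add: corr_def mult.commute)

lemma corr_power_psd: "c \<in> combos A \<Longrightarrow> 0 \<le> kform (\<lambda>x y. corr G f x y ^ n) c c"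
  unfolding corr_def by (rule gram_power_psd)

lemma (in group) sum_translate:
  assumes "g \<in> carrier G"
  shows "(\<Sum>z \<in> carrier G. F (g \<otimes> z)) = (\<Sum>z \<in> carrier G. F z)"
proof (rule sum.reindex_bij_betw)
  show "bij_betw ((\<otimes>) g) (carrier G) (carrier G)"
    by (rule bij_betw_byWitness[where f'="(\<otimes>) (inv g)"])
       (use assms in \<open>auto simp: m_assoc[symmetric]\<close>)
qed

context marked
begin

lemma sym_gens_letters: "sym_gens G s = letter_value G s ` {l. fst l < k}"
proof
  show "sym_gens G s \<subseteq> letter_value G s ` {l. fst l < k}"
  proof
    fix x assume "x \<in> sym_gens G s"
    then obtain i where i: "i < k" "x = s ! i \<or> x = inv (s ! i)"
      using length_s by (auto simp: sym_gens_def in_set_conv_nth)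
    then show "x \<in> letter_value G s ` {l. fst l < k}"
      by (intro image_eqI[of _ _ "(i, x = s ! i)"]) (auto simp: letter_value_def)
  qed
  show "letter_value G s ` {l. fst l < k} \<subseteq> sym_gens G s"
    using length_s by (auto simp: sym_gens_def letter_value_def)
qed

lemma sym_gens_subset: "sym_gens G s \<subseteq> carrier G"
  by (auto simp: sym_gens_letters)

lemma sym_gens_inv: "t \<in> sym_gens G s \<Longrightarrow> inv t \<in> sym_gens G s"
  using s_subset by (auto simp: sym_gens_def subset_iff)

lemma finite_sym_gens: "finite (sym_gens G s)"
  by (simp add: sym_gens_def)

lemma card_sym_gens: "card (sym_gens G s) \<le> 2 * k"
proof -
  have "card (sym_gens G s) \<le> card (set s) + card (m_inv G ` set s)"
    unfolding sym_gens_def by (rule card_Un_le)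
  also have "\<dots> \<le> 2 * card (set s)" using card_image_le[of "set s" "m_inv G"] by simp
  also have "\<dots> \<le> 2 * k" using card_length[of s] length_s by simp
  finally show ?thesis .
qed

text \<open>Edges are left multiplications by generators. As these are injective in the generator,
  the Laplacian becomes a sum over \<open>sym_gens\<close>.\<close>

lemma cayley_neighbours:
  assumes x: "x \<in> carrier G"
  shows "{y. (x, y) \<in> parcs (cayley_graph G s)} = (\<lambda>t. t \<otimes> x) ` sym_gens G s"
proof
  show "{y. (x, y) \<in> parcs (cayley_graph G s)} \<subseteq> (\<lambda>t. t \<otimes> x) ` sym_gens G s"
  proof
    fix y assume "y \<in> {y. (x, y) \<in> parcs (cayley_graph G s)}"
    then have y: "y \<in> carrier G" and t: "x \<otimes> inv y \<in> sym_gens G s"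
      by (auto simp: cayley_graph_def sym_gens_def)
    have "y = inv (x \<otimes> inv y) \<otimes> x" using x y by (simp add: inv_mult_group m_assoc)
    then show "y \<in> (\<lambda>t. t \<otimes> x) ` sym_gens G s" using sym_gens_inv[OF t] by blast
  qed
  show "(\<lambda>t. t \<otimes> x) ` sym_gens G s \<subseteq> {y. (x, y) \<in> parcs (cayley_graph G s)}"
  proof clarify
    fix t assume t: "t \<in> sym_gens G s"
    then have tc: "t \<in> carrier G" using sym_gens_subset by auto
    have "x \<otimes> inv (t \<otimes> x) = inv t"
      using x tc by (simp add: inv_mult_group m_assoc[symmetric])
    then show "(x, t \<otimes> x) \<in> parcs (cayley_graph G s)"
      using x tc sym_gens_inv[OF t] by (auto simp: cayley_graph_def sym_gens_def)
  qed
qed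

lemma inj_on_right_translate: "x \<in> carrier G \<Longrightarrow> inj_on (\<lambda>t. t \<otimes> x) (sym_gens G s)"
  using sym_gens_subset by (auto simp: inj_on_def subset_iff)

lemma cayley_laplacian:
  assumes "x \<in> carrier G"
  shows "graph_laplacian (cayley_graph G s) f x
    = real (card (sym_gens G s)) * f x - (\<Sum>t \<in> sym_gens G s. f (t \<otimes> x))"
  unfolding graph_laplacian_def cayley_neighbours[OF assms]
  by (simp add: sum.reindex[OF inj_on_right_translate[OF assms]] sum_subtractf
      card_image[OF inj_on_right_translate[OF assms]])

end

section \<open>Correlations of a normalized eigenfunction\<close>

locale cayley_eigenfunction = marked G s k
  for G :: "'a monoid" (structure) and s :: "'a list" and k :: nat +
  fixes f :: "'a \<Rightarrow> real" and \<mu> :: real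
  assumes finite_carrier: "finite (carrier G)" and k_pos: "1 \<le> k"
    and normalized: "(\<Sum>z \<in> carrier G. (f z)\<^sup>2) = 1"
    and eigen: "x \<in> carrier G \<Longrightarrow> graph_laplacian (cayley_graph G s) f x = \<mu> * f x"
begin

abbreviation "d \<equiv> card (sym_gens G s)"

lemma d_pos: "0 < d"
  using finite_sym_gens k_pos length_s by (auto simp: card_gt_0_iff sym_gens_def)

lemma sum_gens:
  assumes "x \<in> carrier G"
  shows "(\<Sum>t \<in> sym_gens G s. f (inv t \<otimes> x)) = (real d - \<mu>) * f x"
proof -
  have "bij_betw (m_inv G) (sym_gens G s) (sym_gens G s)"
    by (rule bij_betw_byWitness[where f'="m_inv G"])
       (use sym_gens_subset sym_gens_inv in auto)
  then have "(\<Sum>t \<in> sym_gens G s. f (inv t \<otimes> x)) = (\<Sum>t \<in> sym_gens G s. f (t \<otimes> x))"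
    by (rule sum.reindex_bij_betw)
  then show ?thesis using cayley_laplacian[OF assms, of f] eigen[OF assms] by (simp add: algebra_simps)
qed

lemma norm_translate: "x \<in> carrier G \<Longrightarrow> (\<Sum>z \<in> carrier G. (f (inv x \<otimes> z))\<^sup>2) = 1"
  using sum_translate[of "inv x" "\<lambda>z. (f z)\<^sup>2"] normalized by simp

lemma corr_diag: "x \<in> carrier G \<Longrightarrow> corr G f x x = 1"
  using norm_translate by (simp add: corr_def power2_eq_square)

lemma corr_invariant:
  assumes "g \<in> carrier G" "x \<in> carrier G" "y \<in> carrier G"
  shows "corr G f (g \<otimes> x) (g \<otimes> y) = corr G f x y"
proof -
  have "corr G f (g \<otimes> x) (g \<otimes> y)
      = (\<Sum>z \<in> carrier G. f (inv x \<otimes> (inv g \<otimes> z)) * f (inv y \<otimes> (inv g \<otimes> z)))"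
    unfolding corr_def using assms by (intro sum.cong) (auto simp: inv_mult_group m_assoc)
  also have "\<dots> = corr G f x y"
    unfolding corr_def by (rule sum_translate[of "inv g"]) (use assms in auto)
  finally show ?thesis .
qed

lemma corr_distance:
  assumes "x \<in> carrier G" "y \<in> carrier G"
  shows "1 - corr G f x y = (\<Sum>z \<in> carrier G. (f (inv x \<otimes> z) - f (inv y \<otimes> z))\<^sup>2) / 2"
    and "1 + corr G f x y = (\<Sum>z \<in> carrier G. (f (inv x \<otimes> z) + f (inv y \<otimes> z))\<^sup>2) / 2"
  using norm_translate[OF assms(1)] norm_translate[OF assms(2)]
  by (simp_all add: corr_def power2_diff power2_sum sum.distrib sum_subtractf sum_distrib_left[symmetric] mult.assoc)

lemma abs_corr_le: "x \<in> carrier G \<Longrightarrow> y \<in> carrier G \<Longrightarrow> \<bar>corr G f x y\<bar> \<le> 1"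
  using corr_distance[of x y] sum_nonneg[of "carrier G" "\<lambda>z. (f (inv x \<otimes> z) - f (inv y \<otimes> z))\<^sup>2"]
    sum_nonneg[of "carrier G" "\<lambda>z. (f (inv x \<otimes> z) + f (inv y \<otimes> z))\<^sup>2"]
  by (simp add: abs_le_iff)

text \<open>Multiplying \<open>y\<close> by \<open>t\<close> on the right multiplies the argument of
  \<open>f\<close> by the inverse of \<open>t\<close> on the left of
  \<open>inv y \<otimes> z\<close>, which is one step in the Cayley graph. The sum over
  \<open>t\<close> is then given by the eigenvalue equation.\<close>

lemma corr_step:
  assumes "x \<in> carrier G" "y \<in> carrier G"
  shows "(\<Sum>t \<in> sym_gens G s. corr G f x (y \<otimes> t)) = (real d - \<mu>) * corr G f x y"
proof -
  have "(\<Sum>t \<in> sym_gens G s. corr G f x (y \<otimes> t))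
      = (\<Sum>z \<in> carrier G. \<Sum>t \<in> sym_gens G s. f (inv x \<otimes> z) * f (inv t \<otimes> (inv y \<otimes> z)))"
    unfolding corr_def
  proof (subst sum.swap, intro sum.cong refl)
    fix z t assume z: "z \<in> carrier G" and t: "t \<in> sym_gens G s"
    then have tc: "t \<in> carrier G" using sym_gens_subset by auto
    show "f (inv x \<otimes> z) * f (inv (y \<otimes> t) \<otimes> z) = f (inv x \<otimes> z) * f (inv t \<otimes> (inv y \<otimes> z))"
      using assms z tc by (simp add: inv_mult_group m_assoc)
  qed
  also have "\<dots> = (\<Sum>z \<in> carrier G. f (inv x \<otimes> z) * ((real d - \<mu>) * f (inv y \<otimes> z)))"
    unfolding sum_distrib_left[symmetric] using assms by (intro sum.cong) (auto simp: sum_gens)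
  also have "\<dots> = (real d - \<mu>) * corr G f x y"
    by (simp add: corr_def sum_distrib_left mult_ac)
  finally show ?thesis .
qed

text \<open>The defects over all generators are nonnegative and add up to \<mu>, so none exceeds
  \<mu>.\<close>

lemma corr_gen:
  assumes "t \<in> sym_gens G s"
  shows "1 - corr G f \<one> t \<le> \<mu>"
proof -
  have c: "u \<in> carrier G" if "u \<in> sym_gens G s" for u using that sym_gens_subset by auto
  have "1 - corr G f \<one> t \<le> (\<Sum>u \<in> sym_gens G s. 1 - corr G f \<one> u)"
    using assms finite_sym_gens abs_corr_le[OF one_closed c]
    by (intro member_le_sum) (auto simp: abs_le_iff)
  also have "\<dots> = real d - (\<Sum>u \<in> sym_gens G s. corr G f \<one> (\<one> \<otimes> u))"
    using c by (simp add: sum_subtractf)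
  also have "\<dots> = \<mu>" by (subst corr_step) (simp_all add: corr_diag)
  finally show ?thesis .
qed

text \<open>The defect is half the squared distance of unit vectors, so the triangle inequality
  costs a factor 2. The gap in the scalar inequality is
  \<open>(a - 2 * b + c)\<^sup>2\<close>.\<close>

lemma corr_triangle:
  assumes "x \<in> carrier G" "y \<in> carrier G" "z \<in> carrier G"
  shows "1 - corr G f x z \<le> 2 * (1 - corr G f x y) + 2 * (1 - corr G f y z)"
proof -
  have *: "(a - c)\<^sup>2 \<le> 2 * (a - b)\<^sup>2 + 2 * (b - c)\<^sup>2" for a b c :: real
    using zero_le_power2[of "a - 2 * b + c"] by (simp add: power2_eq_square algebra_simps)
  have "(\<Sum>u \<in> carrier G. (f (inv x \<otimes> u) - f (inv z \<otimes> u))\<^sup>2)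
      \<le> (\<Sum>u \<in> carrier G. 2 * (f (inv x \<otimes> u) - f (inv y \<otimes> u))\<^sup>2 + 2 * (f (inv y \<otimes> u) - f (inv z \<otimes> u))\<^sup>2)"
    by (intro sum_mono *)
  then show ?thesis
    by (simp add: corr_distance assms sum.distrib sum_distrib_left[symmetric])
qed

text \<open>The constant solves \<open>c' = 2 + 2 * c\<close> with initial value 0, from
  \<open>corr_triangle\<close> at each letter. Its size is immaterial: it depends on the length of
  the word alone, not on the group.\<close>

lemma corr_word:
  assumes "w \<in> words k"
  shows "1 - corr G f \<one> (word_value G s w) \<le> (2 ^ (length w + 1) - 2) * \<mu>"
  using assms
proof (induction w)
  case Nil then show ?case by (simp add: corr_diag)
next
  case (Cons l w)
  let ?l = "letter_value G s l" and ?w = "word_value G s w"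
  have l: "?l \<in> carrier G" and w: "?w \<in> carrier G" using Cons.prems by auto
  have "1 - corr G f \<one> (?l \<otimes> ?w) \<le> 2 * (1 - corr G f \<one> ?l) + 2 * (1 - corr G f ?l (?l \<otimes> ?w))"
    by (rule corr_triangle) (use l w in auto)
  also have "corr G f ?l (?l \<otimes> ?w) = corr G f \<one> ?w"
    using corr_invariant[OF l one_closed w] l by simp
  also have "2 * (1 - corr G f \<one> ?l) + 2 * (1 - corr G f \<one> ?w) \<le> 2 * \<mu> + 2 * ((2 ^ (length w + 1) - 2) * \<mu>)"
    using Cons corr_gen[of ?l] by (auto simp: sym_gens_letters)
  also have "\<dots> = (2 ^ (length (l # w) + 1) - 2) * \<mu>" by (simp add: algebra_simps)
  finally show ?case by simp
qed

text \<open>By \<open>corr_step\<close> the average of the correlation over the one-letter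
  extensions of a word is \<open>1 - \<mu> / d\<close> times its value at the word, and some
  extension is at most the average. The assumption keeps this factor nonnegative, so the inductive
  bound may be multiplied by it.\<close>

lemma corr_greedy:
  assumes "\<mu> \<le> d"
  shows "\<exists>w \<in> words k. length w = n \<and> corr G f \<one> (word_value G s w) \<le> (1 - \<mu> / d) ^ n"
proof (induction n)
  case 0 then show ?case by (intro bexI[of _ "[]"]) (auto simp: corr_diag)
next
  case (Suc n)
  then obtain w where w: "w \<in> words k" "length w = n"
    and le: "corr G f \<one> (word_value G s w) \<le> (1 - \<mu> / d) ^ n" by blast
  let ?w = "word_value G s w"
  have "\<exists>t \<in> sym_gens G s. corr G f \<one> (?w \<otimes> t) \<le> (1 - \<mu> / d) * corr G f \<one> ?w"
  proof (rule ccontr)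
    assume "\<not> ?thesis"
    then have "(\<Sum>t \<in> sym_gens G s. (1 - \<mu> / d) * corr G f \<one> ?w) < (\<Sum>t \<in> sym_gens G s. corr G f \<one> (?w \<otimes> t))"
      using d_pos finite_sym_gens by (intro sum_strict_mono) (auto simp: card_gt_0_iff)
    also have "\<dots> = (real d - \<mu>) * corr G f \<one> ?w"
      by (rule corr_step) (use w in auto)
    finally show False using d_pos by (simp add: field_simps)
  qed
  then obtain l where l: "fst l < k"
    and "corr G f \<one> (?w \<otimes> letter_value G s l) \<le> (1 - \<mu> / d) * corr G f \<one> ?w"
    by (auto simp: sym_gens_letters)
  note this(2)
  also have "(1 - \<mu> / d) * corr G f \<one> ?w \<le> (1 - \<mu> / d) * (1 - \<mu> / d) ^ n"
    using assms d_pos by (intro mult_left_mono le) (auto simp: field_simps)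
  finally show ?case
    using w l by (intro bexI[of _ "w @ [l]"]) (auto simp: word_value_append)
qed

end

section \<open>The spectral gap\<close>

text \<open>The powers \<open>corr ^ n\<close> with \<open>n\<close> of order \<open>1 / \<mu>\<close> are the coefficients of tensor powers of the
  representation on functions. They stay close to 1 on short words, but get small on some long
  ones, uniformly in \<open>j\<close>; so their limit violates the rigidity of the limit group.\<close>

lemma no_rigid_limit:
  fixes G :: "nat \<Rightarrow> 'a monoid" and H :: "'b monoid"
  assumes eigen: "\<And>j. cayley_eigenfunction (G j) (s j) k (f j) (\<mu> j)"
    and \<mu>: "\<And>j. 0 < \<mu> j" "\<mu> \<longlonglongrightarrow> 0"
    and H: "marked_group k H t"
    and limit: "\<And>u w. \<lbrakk>u \<in> words k; w \<in> words k; word_value H t u = word_value H t w\<rbrakk> \<Longrightarrow>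
      \<forall>\<^sub>F j in sequentially. word_value (G j) (s j) u = word_value (G j) (s j) w"
    and "kernel_rigid H"
  shows False
proof -
  obtain Q \<epsilon> where Q: "finite Q" "Q \<subseteq> carrier H" and \<epsilon>: "0 < \<epsilon>"
    and rigid: "\<And>K g. \<lbrakk>invariant_kernel H K; K \<one>\<^bsub>H\<^esub> \<one>\<^bsub>H\<^esub> = 1; \<forall>q \<in> Q. 1 - K q \<one>\<^bsub>H\<^esub> < \<epsilon>;
      g \<in> carrier H\<rbrakk> \<Longrightarrow> 1 / 2 \<le> K g \<one>\<^bsub>H\<^esub>"
    using \<open>kernel_rigid H\<close> unfolding kernel_rigid_def by metis
  interpret H: marked H t k using H by (simp add: marked_group_iff)
  interpret E: cayley_eigenfunction "G j" "s j" k "f j" "\<mu> j" for j by (rule eigen)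
  let ?val = "\<lambda>j. word_value (G j) (s j)"
  have "\<forall>x \<in> carrier H. \<exists>w \<in> words k. word_value H t w = x"
    using H by (force simp: marked_group_iff)
  then obtain wd where wd: "\<And>x. x \<in> carrier H \<Longrightarrow> wd x \<in> words k"
    and val_wd: "\<And>x. x \<in> carrier H \<Longrightarrow> word_value H t (wd x) = x" by metis
  define b where "b = (\<lambda>w :: (nat \<times> bool) list. (2::real) ^ (length w + 1))"
  have b_pos: "0 < b w" for w by (simp add: b_def)
  \<comment> \<open>Chosen so that \<open>2 * \<tau> * b (wd q)\<close> is at most
    \<open>\<epsilon> / 2\<close> for every \<open>q\<close>. The sum replaces a maximum, and the 1
    covers an empty \<open>Q\<close>.\<close>
  define \<tau> where "\<tau> = \<epsilon> / (4 * (1 + (\<Sum>q\<in>Q. b (wd q))))"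
  have sum_b: "0 \<le> (\<Sum>q\<in>Q. b (wd q))" by (intro sum_nonneg) (simp add: b_def)
  have \<tau>: "0 < \<tau>" using \<epsilon> sum_b by (simp add: \<tau>_def)
  have \<tau>_small: "2 * \<tau> * b (wd q) < \<epsilon>" if "q \<in> Q" for q
  proof -
    have "b (wd q) \<le> (\<Sum>q\<in>Q. b (wd q))"
      by (rule member_le_sum[OF that]) (use Q in \<open>simp_all add: b_def\<close>)
    then have "2 * \<tau> * b (wd q) \<le> 2 * \<tau> * (1 + (\<Sum>q\<in>Q. b (wd q)))"
      using \<tau> by (intro mult_left_mono) auto
    also have "\<dots> = \<epsilon> / 2" using sum_b by (simp add: \<tau>_def field_simps)
    finally show ?thesis using \<epsilon> by simp
  qed
  \<comment> \<open>Rounding up puts \<open>n * \<mu>\<close> between \<open>\<tau>\<close> and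
    \<open>\<tau> + \<mu>\<close>: the lower bound makes the power small on long words, the upper
    one keeps it near 1 on \<open>Q\<close>.\<close>
  define n where "n = (\<lambda>j. nat \<lceil>\<tau> / \<mu> j\<rceil>)"
  have n_lower: "\<tau> \<le> real (n j) * \<mu> j" and n_upper: "real (n j) * \<mu> j \<le> \<tau> + \<mu> j" for j
  proof -
    have "0 < \<tau> / \<mu> j" using \<tau> \<mu>(1)[of j] by simp
    then have "\<tau> / \<mu> j \<le> real (n j)" "real (n j) \<le> \<tau> / \<mu> j + 1"
      unfolding n_def by linarith+
    then show "\<tau> \<le> real (n j) * \<mu> j" "real (n j) * \<mu> j \<le> \<tau> + \<mu> j"
      using \<mu>(1)[of j] by (simp_all add: field_simps)
  qed
  define F where "F = (\<lambda>j u w. corr (G j) (f j) (?val j u) (?val j w) ^ n j)"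
  have F_bound: "\<bar>F j u w\<bar> \<le> 1" if "u \<in> words k" "w \<in> words k" for j u w
    unfolding F_def power_abs using that by (intro power_le_one E.abs_corr_le) auto
  obtain r :: "nat \<Rightarrow> nat" where r: "strict_mono r"
    and conv: "\<And>p. p \<in> words k \<times> words k \<Longrightarrow> \<exists>l. (\<lambda>j. F (r j) (fst p) (snd p)) \<longlonglongrightarrow> l"
    by (rule function_convergent_subsequence[of "words k \<times> words k" "\<lambda>j p. F j (fst p) (snd p)" 1])
       (use F_bound in auto)
  \<comment> \<open>The limit is taken along one chosen word for each element. By
    \<open>K_lim\<close> other words for the same elements give the same limit, since they
    eventually agree in the groups \<open>G j\<close>.\<close>
  define K where "K = (\<lambda>x y. lim (\<lambda>j. F (r j) (wd x) (wd y)))"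
  have K_wd: "(\<lambda>j. F (r j) (wd x) (wd y)) \<longlonglongrightarrow> K x y" if "x \<in> carrier H" "y \<in> carrier H" for x y
  proof -
    have "convergent (\<lambda>j. F (r j) (wd x) (wd y))"
      using conv[of "(wd x, wd y)"] wd that by (auto simp: convergent_def)
    then show ?thesis by (simp add: K_def convergent_LIMSEQ_iff)
  qed
  have K_lim: "(\<lambda>j. F (r j) u w) \<longlonglongrightarrow> K (word_value H t u) (word_value H t w)"
    if u: "u \<in> words k" and w: "w \<in> words k" for u w
  proof -
    let ?u = "wd (word_value H t u)" and ?w = "wd (word_value H t w)"
    have "\<forall>\<^sub>F j in sequentially. ?val j ?u = ?val j u" "\<forall>\<^sub>F j in sequentially. ?val j ?w = ?val j w"
      using u w by (auto intro!: limit simp: wd val_wd)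
    then have "\<forall>\<^sub>F j in sequentially. F j ?u ?w = F j u w"
      by eventually_elim (simp add: F_def)
    then have "\<forall>\<^sub>F j in sequentially. F (r j) ?u ?w = F (r j) u w" by (rule eventually_subseq[OF r])
    then show ?thesis using K_wd[of "word_value H t u" "word_value H t w"] u w
      by (simp add: tendsto_cong)
  qed
  have K: "invariant_kernel H K"
  proof (unfold_locales)
    fix x y assume "x \<in> carrier H" "y \<in> carrier H"
    then show "K x y = K y x" by (simp add: K_def F_def corr_sym)
  next
    fix c assume c: "c \<in> combos (carrier H)"
    have "(\<lambda>j. kform (\<lambda>x y. F (r j) (wd x) (wd y)) c c) \<longlonglongrightarrow> kform K c c"
      unfolding kform_def using c by (intro tendsto_pairing K_wd) (auto simp: combos_def)
    moreover have "0 \<le> kform (\<lambda>x y. F j (wd x) (wd y)) c c" for j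
    proof -
      have "map (\<lambda>(a, x). (a, ?val j (wd x))) c \<in> combos UNIV" by (simp add: combos_def)
      from corr_power_psd[OF this, of "G j" "f j" "n j"] show ?thesis
        unfolding kform_map F_def .
    qed
    ultimately show "0 \<le> kform K c c" by (intro LIMSEQ_le_const) auto
  next
    fix g x y assume g: "g \<in> carrier H" and x: "x \<in> carrier H" and y: "y \<in> carrier H"
    have "F j (wd g @ wd x) (wd g @ wd y) = F j (wd x) (wd y)" for j
      using wd[OF g] wd[OF x] wd[OF y] by (simp add: F_def E.word_value_append E.corr_invariant)
    then have "(\<lambda>j. F (r j) (wd x) (wd y)) \<longlonglongrightarrow> K (g \<otimes>\<^bsub>H\<^esub> x) (g \<otimes>\<^bsub>H\<^esub> y)"
      using K_lim[of "wd g @ wd x" "wd g @ wd y"] wd g x y by (simp add: H.word_value_append val_wd)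
    then show "K (g \<otimes>\<^bsub>H\<^esub> x) (g \<otimes>\<^bsub>H\<^esub> y) = K x y"
      using K_wd[OF x y] by (rule LIMSEQ_unique)
  qed
  have corr_word: "1 - corr (G j) (f j) (?val j w) \<one>\<^bsub>G j\<^esub> \<le> b w * \<mu> j" if "w \<in> words k" for j w
    using E.corr_word[OF that, of j] \<mu>(1)[of j]
    by (simp add: b_def algebra_simps corr_sym[of _ _ "?val j w"])
  \<comment> \<open>Bernoulli's inequality and the monotonicity of powers below need a nonnegative
    base.\<close>
  have corr_nonneg: "\<forall>\<^sub>F j in sequentially. 0 \<le> corr (G j) (f j) (?val j w) \<one>\<^bsub>G j\<^esub>"
    if "w \<in> words k" for w
  proof -
    have "\<forall>\<^sub>F j in sequentially. \<mu> j < 1 / b w"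
      by (rule order_tendstoD(2)[OF \<mu>(2)]) (use b_pos in simp)
    then show ?thesis
    proof eventually_elim
      case (elim j)
      then have "b w * \<mu> j < 1" using b_pos[of w] by (simp add: field_simps)
      then show ?case using corr_word[OF that, of j] by linarith
    qed
  qed
  have K_one: "(\<lambda>j. F (r j) w []) \<longlonglongrightarrow> K (word_value H t w) \<one>\<^bsub>H\<^esub>" if "w \<in> words k" for w
    using K_lim[OF that, of "[]"] by simp
  have "K \<one>\<^bsub>H\<^esub> \<one>\<^bsub>H\<^esub> = 1"
  proof -
    have "F j [] [] = 1" for j by (simp add: F_def E.corr_diag)
    then have "(\<lambda>j. 1) \<longlonglongrightarrow> K \<one>\<^bsub>H\<^esub> \<one>\<^bsub>H\<^esub>" using K_one[of "[]"] by simp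
    then show ?thesis by (simp add: LIMSEQ_const_iff)
  qed
  moreover have "1 - K q \<one>\<^bsub>H\<^esub> < \<epsilon>" if q: "q \<in> Q" for q
  proof -
    have qH: "q \<in> carrier H" using q Q by auto
    have w: "wd q \<in> words k" by (rule wd[OF qH])
    have "\<forall>\<^sub>F j in sequentially. \<mu> j < \<tau>" by (rule order_tendstoD(2)[OF \<mu>(2) \<tau>])
    with corr_nonneg[OF w] have "\<forall>\<^sub>F j in sequentially. 1 - 2 * \<tau> * b (wd q) \<le> F j (wd q) []"
    proof eventually_elim
      case (elim j)
      let ?c = "corr (G j) (f j) (?val j (wd q)) \<one>\<^bsub>G j\<^esub>"
      \<comment> \<open>With the defect at most \<open>b * \<mu>\<close>, the power is at least
        \<open>1 - n * b * \<mu>\<close>, hence at least \<open>1 - b * (\<tau> + \<mu>)\<close>;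
        once \<open>\<mu> < \<tau>\<close> this exceeds \<open>1 - 2 * \<tau> * b\<close>.\<close>
      have "1 + real (n j) * (?c - 1) \<le> (1 + (?c - 1)) ^ n j"
        by (rule Bernoulli_inequality) (use elim in simp)
      moreover have "real (n j) * (1 - ?c) \<le> real (n j) * (b (wd q) * \<mu> j)"
        by (intro mult_left_mono corr_word w) simp
      moreover have "real (n j) * \<mu> j * b (wd q) \<le> 2 * \<tau> * b (wd q)"
        using n_upper[of j] elim b_pos[of "wd q"] by (intro mult_right_mono) auto
      ultimately show ?case by (simp add: F_def algebra_simps)
    qed
    then have "\<forall>\<^sub>F j in sequentially. 1 - 2 * \<tau> * b (wd q) \<le> F (r j) (wd q) []"
      by (rule eventually_subseq[OF r])
    then have "1 - 2 * \<tau> * b (wd q) \<le> K q \<one>\<^bsub>H\<^esub>"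
      using K_one[OF w] by (intro tendsto_lowerbound[where F=sequentially]) (auto simp: val_wd qH)
    then show ?thesis using \<tau>_small[OF q] by linarith
  qed
  ultimately have half: "1 / 2 \<le> K g \<one>\<^bsub>H\<^esub>" if "g \<in> carrier H" for g
    using rigid[OF K] that by blast
  have k: "0 < real k" using E.k_pos by simp
  \<comment> \<open>This \<open>N\<close> makes \<open>exp (- N * \<tau> / (2 * k))\<close> smaller
    than 1/4, and \<open>2 * k\<close> bounds all degrees, so one length serves every
    \<open>j\<close>.\<close>
  obtain N :: nat where N: "ln 4 < real N * (\<tau> / (2 * k))"
    using reals_Archimedean3[of "\<tau> / (2 * k)"] \<tau> k by auto
  define W where "W = {w \<in> words k. length w = N}"
  have W: "finite W" unfolding W_def by (rule finite_words_length)
  \<comment> \<open>The word supplied by \<open>corr_greedy\<close> varies with \<open>j\<close>.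
    Since there are only finitely many words of length \<open>N\<close>, the lower bound can be
    secured for all of them at once; 1/4 leaves room below the limit value 1/2.\<close>
  have "\<forall>\<^sub>F j in sequentially. \<forall>w\<in>W. 1 / 4 < F (r j) w []"
  proof (rule eventually_ball_finite[OF W], rule ballI)
    fix w assume "w \<in> W"
    then have w: "w \<in> words k" by (simp add: W_def)
    have "1 / 4 < K (word_value H t w) \<one>\<^bsub>H\<^esub>" using half[of "word_value H t w"] w by simp
    then show "\<forall>\<^sub>F j in sequentially. 1 / 4 < F (r j) w []"
      by (rule order_tendstoD(1)[OF K_one[OF w]])
  qed
  moreover have "\<forall>\<^sub>F j in sequentially. \<forall>w\<in>W. 0 \<le> corr (G (r j)) (f (r j)) (?val (r j) w) \<one>\<^bsub>G (r j)\<^esub>"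
    by (rule eventually_subseq[OF r], rule eventually_ball_finite[OF W])
       (simp add: W_def corr_nonneg)
  moreover have "\<forall>\<^sub>F j in sequentially. \<mu> (r j) < 1"
    by (rule eventually_subseq[OF r], rule order_tendstoD(2)[OF \<mu>(2)]) simp
  ultimately have "\<forall>\<^sub>F j in sequentially. False"
  proof eventually_elim
    case (elim j)
    let ?j = "r j"
    let ?d = "real (card (sym_gens (G ?j) (s ?j)))"
    have d: "1 \<le> ?d" "?d \<le> 2 * k"
      using E.d_pos[of ?j] E.card_sym_gens[of ?j] by (auto simp: Suc_le_eq[symmetric])
    have "\<mu> ?j \<le> ?d" using d elim by linarith
    from E.corr_greedy[OF this, of N] obtain w where w: "w \<in> W"
      and le: "corr (G ?j) (f ?j) \<one>\<^bsub>G ?j\<^esub> (?val ?j w) \<le> (1 - \<mu> ?j / ?d) ^ N"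
      by (auto simp: W_def)
    have "F ?j w [] \<le> ((1 - \<mu> ?j / ?d) ^ N) ^ n ?j"
      unfolding F_def using elim w le by (intro power_mono) (auto simp: corr_sym)
    also have "\<dots> \<le> (exp (- (\<mu> ?j / ?d)) ^ N) ^ n ?j"
      using exp_ge_add_one_self[of "- (\<mu> ?j / ?d)"] \<open>\<mu> ?j \<le> ?d\<close> d
      by (intro power_mono zero_le_power) auto
    also have "\<dots> = exp (- (real N * (real (n ?j) * \<mu> ?j / ?d)))"
      by (simp add: exp_of_nat_mult[symmetric] mult_ac)
    also have "\<dots> \<le> exp (- (real N * (\<tau> / (2 * k))))"
    proof -
      have "\<tau> / (2 * k) \<le> real (n ?j) * \<mu> ?j / ?d"
        using n_lower[of ?j] d \<tau> by (intro frac_le) auto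
      then have "real N * (\<tau> / (2 * k)) \<le> real N * (real (n ?j) * \<mu> ?j / ?d)"
        by (rule mult_left_mono) simp
      then show ?thesis by (simp only: exp_le_cancel_iff neg_le_iff_le)
    qed
    also have "\<dots> < exp (- ln 4)" using N by simp
    also have "\<dots> = 1 / 4" by (simp add: exp_minus)
    finally show False using elim w by force
  qed
  then show False by simp
qed

section \<open>Cayley graphs as finite connected graphs of bounded degree\<close>

lemma (in marked) cayley_pair_pseudo_graph:
  assumes "finite (carrier G)"
  shows "pair_pseudo_graph (cayley_graph G s)"
proof (unfold_locales)
  have sub: "parcs (cayley_graph G s) \<subseteq> carrier G \<times> carrier G" by (auto simp: cayley_graph_def)
  then show "finite (parcs (cayley_graph G s))" using assms finite_subset by blast
  show "finite (pverts (cayley_graph G s))" using assms by (simp add: cayley_graph_def)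
  show "fst e \<in> pverts (cayley_graph G s)" "snd e \<in> pverts (cayley_graph G s)"
    if "e \<in> parcs (cayley_graph G s)" for e
    using sub that by (auto simp: cayley_graph_def)
  have "(y, x) \<in> parcs (cayley_graph G s)" if "(x, y) \<in> parcs (cayley_graph G s)" for x y
  proof -
    have xy: "x \<in> carrier G" "y \<in> carrier G" "x \<otimes> inv y \<in> sym_gens G s"
      using that by (auto simp: cayley_graph_def sym_gens_def)
    then have "y \<otimes> inv x \<in> sym_gens G s"
      using sym_gens_inv[OF xy(3)] by (simp add: inv_mult_group)
    then show ?thesis using xy by (simp add: cayley_graph_def sym_gens_def)
  qed
  then show "symmetric (cayley_graph G s)"
    by (auto simp: symmetric_def intro!: symI)
qed

text \<open>Stripping letters from the left of a word for \<open>x \<otimes> inv y\<close> is a walk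
  from \<open>x\<close> to \<open>y\<close>, because edges are left multiplications.\<close>

lemma (in marked) cayley_connected:
  assumes "finite (carrier G)" and words: "carrier G = word_value G s ` words k"
  shows "Digraph_Component.connected (with_proj (cayley_graph G s))"
proof -
  interpret C: pair_pseudo_graph "cayley_graph G s" by (rule cayley_pair_pseudo_graph[OF assms(1)])
  have reach: "reachable (with_proj (cayley_graph G s)) (word_value G s w \<otimes> x) x"
    if "x \<in> carrier G" "w \<in> words k" for w x
    using that(2)
  proof (induction w)
    case Nil
    have "x \<in> verts (with_proj (cayley_graph G s))" using that by (simp add: cayley_graph_def)
    then show ?case using that by simp
  next
    case (Cons l w)
    let ?l = "letter_value G s l" and ?y = "word_value G s w \<otimes> x"
    have l: "?l \<in> carrier G" "?l \<in> sym_gens G s" using Cons.prems by (auto simp: sym_gens_letters)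
    have y: "?y \<in> carrier G" using Cons.prems that by simp
    have "(?l \<otimes> ?y) \<otimes> inv ?y = ?l" using l y by (simp add: m_assoc)
    then have "(?l \<otimes> ?y, ?y) \<in> parcs (cayley_graph G s)"
      using l y by (auto simp: cayley_graph_def sym_gens_def)
    then have "reachable (with_proj (cayley_graph G s)) (?l \<otimes> ?y) x"
      using Cons by (auto intro: C.adj_reachable_trans)
    then show ?case using Cons.prems that l by (simp add: m_assoc)
  qed
  have "strongly_connected (with_proj (cayley_graph G s))"
    unfolding strongly_connected_def
  proof (intro conjI ballI)
    show "verts (with_proj (cayley_graph G s)) \<noteq> {}" using one_closed by (auto simp: cayley_graph_def)
    fix x y assume "x \<in> verts (with_proj (cayley_graph G s))" "y \<in> verts (with_proj (cayley_graph G s))"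
    then have x: "x \<in> carrier G" and y: "y \<in> carrier G" by (auto simp: cayley_graph_def)
    then have "x \<otimes> inv y \<in> word_value G s ` words k" using words by blast
    then obtain w where w: "w \<in> words k" "word_value G s w = x \<otimes> inv y" by auto
    from reach[OF y w(1)] show "reachable (with_proj (cayley_graph G s)) x y"
      using x y by (simp add: w(2) m_assoc)
  qed
  then show ?thesis
    unfolding connected_def strongly_connected_def by (auto intro: C.reachable_mk_symmetricI)
qed

lemma (in marked) cayley_out_degree:
  assumes "x \<in> carrier G"
  shows "out_degree (with_proj (cayley_graph G s)) x \<le> 2 * k"
proof -
  have "out_arcs (with_proj (cayley_graph G s)) x = Pair x ` {y. (x, y) \<in> parcs (cayley_graph G s)}"
    by (auto simp: out_arcs_def)
  then have "out_degree (with_proj (cayley_graph G s)) x \<le> card (sym_gens G s)"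
    unfolding out_degree_def cayley_neighbours[OF assms] image_image
    by (simp add: card_image_le finite_sym_gens)
  then show ?thesis using card_sym_gens by simp
qed

lemma (in marked) normalized_eigenfunction:
  assumes "1 \<le> k" "finite (carrier G)" "laplacian_eigenvalue (cayley_graph G s) \<mu>"
  shows "\<exists>f. cayley_eigenfunction G s k f \<mu>"
proof -
  obtain f where f: "\<exists>x \<in> carrier G. f x \<noteq> 0"
    and eigen: "\<And>x. x \<in> carrier G \<Longrightarrow> graph_laplacian (cayley_graph G s) f x = \<mu> * f x"
    using assms(3) by (auto simp: laplacian_eigenvalue_def cayley_graph_def)
  define m where "m = sqrt (\<Sum>z \<in> carrier G. (f z)\<^sup>2)"
  have m: "0 < m"
    unfolding m_def using f assms(2) by (auto intro!: sum_pos2)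
  have m2: "m\<^sup>2 = (\<Sum>z \<in> carrier G. (f z)\<^sup>2)"
    unfolding m_def by (simp add: sum_nonneg)
  have "cayley_eigenfunction G s k (\<lambda>x. f x / m) \<mu>"
  proof
    show "(\<Sum>z \<in> carrier G. (f z / m)\<^sup>2) = 1"
      using m by (simp add: power_divide sum_divide_distrib[symmetric] m2[symmetric])
    show "graph_laplacian (cayley_graph G s) (\<lambda>x. f x / m) x = \<mu> * (f x / m)" if "x \<in> carrier G" for x
      using eigen[OF that] by (simp add: graph_laplacian_def diff_divide_distrib[symmetric] sum_divide_distrib[symmetric])
  qed (use assms in auto)
  then show ?thesis by blast
qed

theorem corollary1p2:
  fixes k :: nat and G :: "nat \<Rightarrow> 'a monoid" and s :: "nat \<Rightarrow> 'a list"
  assumes "1 \<le> k"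
    and "\<And>m. marked_group k (G m) (s m)"
    and "\<And>m. finite (carrier (G m))"
    and "\<And>c. c \<in> cayley_boundary k (\<lambda>m. marked_class_of k (G m) (s m)) \<Longrightarrow> class_property_T c"
  shows "expander_family (\<lambda>m. cayley_graph (G m) (s m))"
proof -
  interpret M: marked "G m" "s m" k for m using assms(2) by (simp add: marked_group_iff)
  have words: "carrier (G m) = word_value (G m) (s m) ` words k" for m
    using assms(2) by (simp add: marked_group_iff)
  have gap: "\<exists>\<epsilon> > 0. \<forall>i \<mu>. first_positive_eigenvalue (cayley_graph (G i) (s i)) \<mu> \<longrightarrow> \<epsilon> \<le> \<mu>"
  proof (rule ccontr)
    assume contr: "\<not> ?thesis"
    have "\<exists>i \<mu>. first_positive_eigenvalue (cayley_graph (G i) (s i)) \<mu> \<and> \<mu> < 1 / real (Suc n)" for n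
    proof -
      have "0 < 1 / real (Suc n)" by simp
      with contr show ?thesis by (meson not_le)
    qed
    then obtain i \<mu> where \<mu>: "\<And>n. first_positive_eigenvalue (cayley_graph (G (i n)) (s (i n))) (\<mu> n)"
      and small: "\<And>n. \<mu> n < 1 / real (Suc n)" by metis
    have pos: "0 < \<mu> n" and ev: "laplacian_eigenvalue (cayley_graph (G (i n)) (s (i n))) (\<mu> n)" for n
      using \<mu>[of n] by (auto simp: first_positive_eigenvalue_def)
    have "\<exists>f. \<forall>n. cayley_eigenfunction (G (i n)) (s (i n)) k (f n) (\<mu> n)"
      by (intro choice allI M.normalized_eigenfunction assms ev)
    then obtain f where f: "\<And>n. cayley_eigenfunction (G (i n)) (s (i n)) k (f n) (\<mu> n)" by blast
    have "\<mu> \<longlonglongrightarrow> 0"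
    proof (rule tendsto_sandwich[OF _ _ tendsto_const])
      show "(\<lambda>n. 1 / real (Suc n)) \<longlonglongrightarrow> 0" using LIMSEQ_inverse_real_of_nat by (simp add: inverse_eq_divide)
    qed (use pos small in \<open>auto simp: less_imp_le\<close>)
    obtain r :: "nat \<Rightarrow> nat" and H :: "nat monoid" and t where r: "strict_mono r" and H: "marked_group k H t"
      and eq: "\<And>u w. u \<in> words k \<Longrightarrow> w \<in> words k \<Longrightarrow> word_value H t u = word_value H t w \<Longrightarrow>
        \<forall>\<^sub>F j in sequentially. word_value (G (i (r j))) (s (i (r j))) u = word_value (G (i (r j))) (s (i (r j))) w"
      and neq: "\<And>u w. u \<in> words k \<Longrightarrow> w \<in> words k \<Longrightarrow> word_value H t u \<noteq> word_value H t w \<Longrightarrow>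
        \<forall>\<^sub>F j in sequentially. word_value (G (i (r j))) (s (i (r j))) u \<noteq> word_value (G (i (r j))) (s (i (r j))) w"
      using marked_convergent_subsequence[of k "\<lambda>n. G (i n)" "\<lambda>n. s (i n)"] assms(2) by blast
    let ?c = "\<lambda>m. marked_class_of k (G m) (s m)" and ?L = "marked_class_of k H t"
    have closure: "?L \<in> (cayley_topology k) closure_of (range ?c)"
    proof (rule cayley_closureI)
      fix w assume "w \<in> free_group_words k"
      then have w: "w \<in> words k" using free_group_words_subset by blast
      \<comment> \<open>Comparing \<open>w\<close> with the empty word, \<open>eq\<close> handles
        the relators of the limit and \<open>neq\<close> the words outside its relators, as the
        complements in the subbasis demand.\<close>
      show "\<forall>\<^sub>F j in sequentially. ?c (i (r j)) \<in> relator_set k w \<longleftrightarrow> ?L \<in> relator_set k w"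
        unfolding relator_set_iff[OF assms(2) w] relator_set_iff[OF H w]
        using eq[OF w words_Nil] neq[OF w words_Nil]
        by (cases "word_value H t w = \<one>\<^bsub>H\<^esub>") (auto elim: eventually_mono)
    qed (use marked_class_of_in assms(2) H in auto)
    have "group H" using H by (simp add: marked_group_def)
    have "kernel_rigid H"
    proof (cases "?L \<in> range ?c")
      case True
      then obtain m where "?L = ?c m" by blast
      then have "(H, t) \<in> ?c m" using marked_class_of_self[OF H] by simp
      then have "G m \<cong> H" by (auto simp: marked_class_of_def marked_iso_def is_iso_def)
      then have "finite (carrier H)" using iso_finite[of "G m" H] assms(3) by blast
      then show ?thesis by (rule finite_kernel_rigid)
    next
      case False
      then have "class_property_T ?L" using assms(4) closure by (simp add: cayley_boundary_def)
      then have "property_T H" using marked_class_of_self[OF H] by (auto simp: class_property_T_def)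
      then show ?thesis by (rule property_T_kernel_rigid[OF \<open>group H\<close>])
    qed
    moreover have "(\<lambda>j. \<mu> (r j)) \<longlonglongrightarrow> 0"
      using LIMSEQ_subseq_LIMSEQ[OF \<open>\<mu> \<longlonglongrightarrow> 0\<close> r] by (simp add: o_def)
    ultimately show False
      by (intro no_rigid_limit[of "\<lambda>j. G (i (r j))" "\<lambda>j. s (i (r j))" k "\<lambda>j. f (r j)" "\<lambda>j. \<mu> (r j)" H t]
          f pos H eq)
  qed
  have "\<forall>i. \<forall>v \<in> pverts (cayley_graph (G i) (s i)).
      out_degree (with_proj (cayley_graph (G i) (s i))) v \<le> 2 * k"
    using M.cayley_out_degree by (simp add: cayley_graph_def)
  then show ?thesis
    unfolding expander_family_def
    using gap M.cayley_pair_pseudo_graph M.cayley_connected assms(3) words by blast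
qed

end
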